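(* Let $G$ be a directed graph on four vertices whose underlying undirected graph is one of the following connected subgraphs of $K_4$: the complete graph $K_4$; the graph $G_1$ obtained from $K_4$ by deleting one edge; the graph $G_2$ consisting of a triangle together with a fourth vertex joined by an edge to exactly one vertex of the triangle; the 4-cycle $C_4$; the path $P_4$ on four vertices. Let $\mathfrak n_G$ be the associated metric 2-step nilpotent Lie algebra and let $N$ be the simply connected 2-step nilpotent Lie group with Lie algebra $\mathfrak n_G$, with the left invariant Riemannian metric determined by the inner product. Then for any lattice $\Gamma$ in $N$, the manifold $\Gamma\backslash N$ has the density of closed geodesics property.
   Context: Construction of $\mathfrak{n}_G$: let $G=(S,E)$ be a finite simple directed graph with at least one edge, with vertex set $S=\{X_1,\dots,X_m\}$ and edge set $E=\{Z_1,\dots,Z_q\}$. Let $\mathcal V$ be the real vector space with basis $S$, $\mathfrak z$ the real vector space with basis $E$, and $\mathfrak n_G=\mathcal V\oplus\mathfrak z$. The Lie bracket is the bilinear skew-symmetric extension of: $[X_i,X_l]=Z_k$ if $Z_k$ is a directed edge from $X_i$ to $X_l$; $[X_i,X_l]=0$ if $X_i,X_l$ are not adjacent; and $[\mathfrak n_G,\mathfrak z]=0$. The inner product is the one making $S\cup E$ orthonormal. A lattice $\Gamma\subseteq N$ is a discrete cocompact subgroup; $\Gamma\backslash N$ carries the Riemannian metric induced by the left invariant metric on $N$. A compact Riemannian manifold $M$ has the density of closed geodesics property if the (unit) vectors tangent to smoothly closed geodesics are dense in the unit tangent bundle of $M$. *)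

theory Defs
  imports
    "HOL-Analysis.Analysis"
    "HOL-Algebra.Coset"
    "Graph_Theory.Digraph"
begin

section \<open>Directed graphs and their underlying undirected graphs\<close>

text \<open>
  A simple directed graph has at most one arc between two given vertices, so pairs of opposite
  arcs are excluded as well: for such a pair the relations \<open>[X, Y] = Z\<close> and \<open>[Y, X] = Z'\<close> would
  contradict skew-symmetry.
\<close>

definition simple_digraph :: "('v, 'e) pre_digraph \<Rightarrow> bool" where
  "simple_digraph G \<longleftrightarrow> digraph G \<and> asym (arcs_ends G)"

definition underlying_edges :: "('v, 'e) pre_digraph \<Rightarrow> 'v set set" where
  "underlying_edges G = (\<lambda>e. {tail G e, head G e}) ` arcs G"

text \<open>The underlying graph of \<open>G\<close> is isomorphic to the graph with vertices \<open>V\<close>, edges \<open>F\<close>.\<close>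

definition underlying_graph_iso :: "('v, 'e) pre_digraph \<Rightarrow> 'a set \<Rightarrow> 'a set set \<Rightarrow> bool" where
  "underlying_graph_iso G V F \<longleftrightarrow>
     (\<exists>f. bij_betw f V (verts G) \<and> underlying_edges G = (\<lambda>s. f ` s) ` F)"

definition K4_edges :: "nat set set" where
  "K4_edges = {{0, 1}, {0, 2}, {0, 3}, {1, 2}, {1, 3}, {2, 3}}"

definition G1_edges :: "nat set set" where
  "G1_edges = K4_edges - {{2, 3}}"

definition G2_edges :: "nat set set" where
  "G2_edges = {{0, 1}, {1, 2}, {0, 2}, {2, 3}}"

definition C4_edges :: "nat set set" where
  "C4_edges = {{0, 1}, {1, 2}, {2, 3}, {0, 3}}"

definition P4_edges :: "nat set set" where
  "P4_edges = {{0, 1}, {1, 2}, {2, 3}}"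


section \<open>The metric two-step nilpotent Lie algebra of a directed graph\<close>

text \<open>
  For a graph with vertex set \<open>UNIV :: 'v set\<close> and arc set \<open>UNIV :: 'e set\<close>, the Lie algebra is
  \<open>(real ^ 'v) \<times> (real ^ 'e)\<close> with its standard inner product, for which the vectors
  \<open>(axis i 1, 0)\<close> (the vertices) and \<open>(0, axis e 1)\<close> (the edges) are an orthonormal basis.
  The bracket is given in coordinates; \<open>graph_bracket_unique\<close> below shows that it is the bilinear
  extension of the relations between basis vectors.
\<close>

definition graph_bracket ::
    "('v::finite, 'e::finite) pre_digraph \<Rightarrow> (real ^ 'v) \<times> (real ^ 'e) \<Rightarrow>
       (real ^ 'v) \<times> (real ^ 'e) \<Rightarrow> (real ^ 'v) \<times> (real ^ 'e)" where
  "graph_bracket G x y =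
     (0, \<chi> e. fst x $ tail G e * fst y $ head G e - fst x $ head G e * fst y $ tail G e)"

lemma bilinear_graph_bracket: "bilinear (graph_bracket G)"
  unfolding bilinear_def graph_bracket_def
  by (auto intro!: linearI simp: prod_eq_iff vec_eq_iff algebra_simps)

lemma graph_bracket_skew: "graph_bracket G x y = - graph_bracket G y x"
  by (simp add: graph_bracket_def prod_eq_iff vec_eq_iff)

lemma graph_bracket_centre [simp]:
  "graph_bracket G x (0, z) = 0" "graph_bracket G (0, z) x = 0"
  by (simp_all add: graph_bracket_def prod_eq_iff vec_eq_iff)

lemma graph_bracket_bracket [simp]:
  "graph_bracket G x (graph_bracket G y z) = 0" "graph_bracket G (graph_bracket G y z) x = 0"
  by (simp_all add: graph_bracket_def prod_eq_iff vec_eq_iff)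

lemma graph_bracket_arc:
  assumes "simple_digraph G" "arcs G = UNIV"
  shows "graph_bracket G (axis (tail G e) 1, 0) (axis (head G e) 1, 0) = (0, axis e 1)"
proof -
  interpret digraph G using assms(1) by (simp add: simple_digraph_def)
  have 1: "e' = e" if "tail G e' = tail G e" "head G e' = head G e" for e'
    using that no_multi_arcs[of e' e] assms(2) by (simp add: arc_to_ends_def)
  have 2: "\<not> (head G e' = tail G e \<and> tail G e' = head G e)" for e'
  proof
    assume *: "head G e' = tail G e \<and> tail G e' = head G e"
    have "(tail G e, head G e) \<in> arcs_ends G" "(tail G e', head G e') \<in> arcs_ends G"
      using assms(2) by (auto simp: arcs_ends_conv)
    with * show False using assms(1) by (auto simp: simple_digraph_def dest: asymD)
  qed
  show ?thesis
    using 1 2 by (auto simp: graph_bracket_def prod_eq_iff vec_eq_iff axis_def)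
qed

lemma graph_bracket_nonadjacent:
  assumes "arcs G = UNIV" "(i, l) \<notin> arcs_ends G" "(l, i) \<notin> arcs_ends G"
  shows "graph_bracket G (axis i 1, 0) (axis l 1, 0) = 0"
  using assms
  by (auto simp: graph_bracket_def prod_eq_iff vec_eq_iff axis_def arcs_ends_conv image_iff)

lemma graph_bracket_unique:
  fixes B :: "(real ^ 'v) \<times> (real ^ 'e) \<Rightarrow> (real ^ 'v) \<times> (real ^ 'e) \<Rightarrow> (real ^ 'v) \<times> (real ^ 'e)"
    and G :: "('v::finite, 'e::finite) pre_digraph"
  assumes G: "simple_digraph G" "arcs G = UNIV"
    and B: "bilinear B" "\<And>x y. B x y = - B y x"
    and arc: "\<And>e. B (axis (tail G e) 1, 0) (axis (head G e) 1, 0) = (0, axis e 1)"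
    and nonadjacent: "\<And>i l. (i, l) \<notin> arcs_ends G \<Longrightarrow> (l, i) \<notin> arcs_ends G \<Longrightarrow>
      B (axis i 1, 0) (axis l 1, 0) = 0"
    and centre: "\<And>x z. B x (0, z) = 0"
  shows "B = graph_bracket G"
proof -
  have vv: "B (axis i 1, 0) (axis l 1, 0) = graph_bracket G (axis i 1, 0) (axis l 1, 0)" for i l
  proof -
    consider e where "i = tail G e" "l = head G e" | e where "l = tail G e" "i = head G e"
      | "(i, l) \<notin> arcs_ends G" "(l, i) \<notin> arcs_ends G"
      by (auto simp: arcs_ends_conv)
    then show ?thesis
    proof cases
      case 1 then show ?thesis by (simp add: arc graph_bracket_arc[OF G])
    next
      case (2 e)
      then show ?thesis
        using arc[of e] graph_bracket_arc[OF G, of e] B(2) graph_bracket_skew by metis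
    next
      case 3 then show ?thesis by (simp add: nonadjacent graph_bracket_nonadjacent G)
    qed
  qed
  have zl: "B (0, z) x = 0" for x z
    using B(2)[of "(0, z)" x] centre by simp
  have "B b c = graph_bracket G b c" if "b \<in> Basis" "c \<in> Basis" for b c
    using that vv by (auto simp: Basis_prod_def Basis_vec_def centre zl)
  then show ?thesis
    using bilinear_eq_stdbasis[OF B(1) bilinear_graph_bracket, of G]
    by (metis ext)
qed


section \<open>The simply connected group with this Lie algebra\<close>

text \<open>
  The simply connected nilpotent Lie group of a nilpotent Lie algebra is diffeomorphic to it by the
  exponential map. In these global coordinates the group is the vector space itself with the
  Baker-Campbell-Hausdorff product, which for a two-step algebra is \<open>x + y + [x, y] / 2\<close>.
\<close>

definition graph_group ::
    "('v::finite, 'e::finite) pre_digraph \<Rightarrow> ((real ^ 'v) \<times> (real ^ 'e)) monoid" where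
  "graph_group G = \<lparr>carrier = UNIV,
     monoid.mult = (\<lambda>x y. x + y + (1/2) *\<^sub>R graph_bracket G x y), one = 0\<rparr>"

lemmas graph_bracket_bilinear_simps =
  bilinear_ladd[OF bilinear_graph_bracket] bilinear_radd[OF bilinear_graph_bracket]
  bilinear_lmul[OF bilinear_graph_bracket] bilinear_rmul[OF bilinear_graph_bracket]
  bilinear_lneg[OF bilinear_graph_bracket] bilinear_rneg[OF bilinear_graph_bracket]
  bilinear_lzero[OF bilinear_graph_bracket] bilinear_rzero[OF bilinear_graph_bracket]

lemma graph_bracket_self [simp]: "graph_bracket G x x = 0"
  by (simp add: graph_bracket_def prod_eq_iff vec_eq_iff)

lemma carrier_graph_group [simp]: "carrier (graph_group G) = UNIV"
  and one_graph_group [simp]: "\<one>\<^bsub>graph_group G\<^esub> = 0"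
  and mult_graph_group:
    "x \<otimes>\<^bsub>graph_group G\<^esub> y = x + y + (1/2) *\<^sub>R graph_bracket G x y"
  by (simp_all add: graph_group_def)

lemma group_graph_group: "group (graph_group G)"
proof (rule groupI)
  fix x
  show "\<exists>y\<in>carrier (graph_group G). y \<otimes>\<^bsub>graph_group G\<^esub> x = \<one>\<^bsub>graph_group G\<^esub>"
    by (intro bexI[of _ "- x"]) (simp_all add: mult_graph_group graph_bracket_bilinear_simps)
qed (simp_all add: mult_graph_group graph_bracket_bilinear_simps scaleR_add_right)

lemma inv_graph_group: "inv\<^bsub>graph_group G\<^esub> x = - x"
  by (rule group.inv_equality[OF group_graph_group])
     (simp_all add: mult_graph_group graph_bracket_bilinear_simps)


section \<open>Left invariant metrics and geodesics\<close>

text \<open>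
  In this section \<open>N\<close> is a Lie group structure on a Euclidean space (in one global chart), and
  every tangent space is identified with that Euclidean space. The inner product of the type is
  used as inner product on the tangent space at the identity.
\<close>

definition left_diff :: "('a::euclidean_space) monoid \<Rightarrow> 'a \<Rightarrow> 'a \<Rightarrow> 'a \<Rightarrow> 'a" where
  "left_diff N a p = frechet_derivative (\<lambda>q. a \<otimes>\<^bsub>N\<^esub> q) (at p)"

definition left_invariant_metric :: "('a::euclidean_space) monoid \<Rightarrow> 'a \<Rightarrow> 'a \<Rightarrow> 'a \<Rightarrow> real" where
  "left_invariant_metric N p u v =
     left_diff N (inv\<^bsub>N\<^esub> p) p u \<bullet> left_diff N (inv\<^bsub>N\<^esub> p) p v"

text \<open>
  Christoffel symbol of the first kind of a Riemannian metric \<open>g\<close> on a Euclidean space: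
  the inner product with \<open>w\<close> of the Levi-Civita derivative of the constant vector field \<open>v\<close> in
  direction \<open>u\<close>, by the Koszul formula.
\<close>

definition christoffel ::
    "('a::euclidean_space \<Rightarrow> 'a \<Rightarrow> 'a \<Rightarrow> real) \<Rightarrow> 'a \<Rightarrow> 'a \<Rightarrow> 'a \<Rightarrow> 'a \<Rightarrow> real" where
  "christoffel g p u v w =
     (frechet_derivative (\<lambda>q. g q v w) (at p) u
    + frechet_derivative (\<lambda>q. g q u w) (at p) v
    - frechet_derivative (\<lambda>q. g q u v) (at p) w) / 2"

text \<open>The geodesic equation, paired with an arbitrary tangent vector \<open>w\<close>.\<close>

definition geodesic_on ::
    "('a::euclidean_space \<Rightarrow> 'a \<Rightarrow> 'a \<Rightarrow> real) \<Rightarrow> (real \<Rightarrow> 'a) \<Rightarrow> real set \<Rightarrow> bool" where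
  "geodesic_on g \<gamma> T \<longleftrightarrow>
     (\<exists>\<gamma>' \<gamma>''. \<forall>t\<in>T. (\<gamma> has_vector_derivative \<gamma>' t) (at t)
        \<and> (\<gamma>' has_vector_derivative \<gamma>'' t) (at t)
        \<and> (\<forall>w. g (\<gamma> t) (\<gamma>'' t) w + christoffel g (\<gamma> t) (\<gamma>' t) (\<gamma>' t) w = 0))"


section \<open>Quotients by lattices\<close>

definition quotient_topology :: "'a topology \<Rightarrow> ('a \<Rightarrow> 'b) \<Rightarrow> 'b topology" where
  "quotient_topology X f =
     topology (\<lambda>U. U \<subseteq> f ` topspace X \<and> openin X {x \<in> topspace X. f x \<in> U})"

lemma openin_quotient_topology:
  "openin (quotient_topology X f) U \<longleftrightarrow>
     U \<subseteq> f ` topspace X \<and> openin X {x \<in> topspace X. f x \<in> U}"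
proof -
  have "istopology (\<lambda>U. U \<subseteq> f ` topspace X \<and> openin X {x \<in> topspace X. f x \<in> U})"
    unfolding istopology_def
  proof (intro conjI allI impI)
    fix S T
    assume "S \<subseteq> f ` topspace X \<and> openin X {x \<in> topspace X. f x \<in> S}"
      and "T \<subseteq> f ` topspace X \<and> openin X {x \<in> topspace X. f x \<in> T}"
    moreover have "{x \<in> topspace X. f x \<in> S \<inter> T} =
        {x \<in> topspace X. f x \<in> S} \<inter> {x \<in> topspace X. f x \<in> T}" by auto
    ultimately show "S \<inter> T \<subseteq> f ` topspace X" "openin X {x \<in> topspace X. f x \<in> S \<inter> T}"
      by auto
  next
    fix K
    assume *: "\<forall>S\<in>K. S \<subseteq> f ` topspace X \<and> openin X {x \<in> topspace X. f x \<in> S}"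
    have "{x \<in> topspace X. f x \<in> \<Union>K} = (\<Union>S\<in>K. {x \<in> topspace X. f x \<in> S})" by auto
    with * show "\<Union>K \<subseteq> f ` topspace X" "openin X {x \<in> topspace X. f x \<in> \<Union>K}"
      by auto
  qed
  then show ?thesis by (simp add: quotient_topology_def)
qed

lemma topspace_quotient_topology [simp]: "topspace (quotient_topology X f) = f ` topspace X"
proof -
  have "{x \<in> topspace X. f x \<in> f ` topspace X} = topspace X" by auto
  then have "openin (quotient_topology X f) (f ` topspace X)"
    by (simp add: openin_quotient_topology)
  then show ?thesis
    by (metis openin_quotient_topology openin_topspace openin_subset subset_antisym)
qed

lemma quotient_map_quotient_topology: "quotient_map X (quotient_topology X f) f"
  by (auto simp: quotient_map_def openin_quotient_topology)

text \<open>The point of \<open>\<Gamma>\N\<close> represented by \<open>p\<close>.\<close>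

abbreviation quotient_point :: "('a::euclidean_space) monoid \<Rightarrow> 'a set \<Rightarrow> 'a \<Rightarrow> 'a set" where
  "quotient_point N \<Gamma> p \<equiv> \<Gamma> #>\<^bsub>N\<^esub> p"

definition lattice_in :: "('a::euclidean_space) monoid \<Rightarrow> 'a set \<Rightarrow> bool" where
  "lattice_in N \<Gamma> \<longleftrightarrow> subgroup \<Gamma> N \<and> discrete \<Gamma>
     \<and> compact_space (quotient_topology euclidean (quotient_point N \<Gamma>))"

text \<open>
  Tangent vectors of \<open>\<Gamma>\N\<close> are orbits of pairs \<open>(p, u)\<close>, where \<open>u\<close> is tangent to \<open>N\<close> at \<open>p\<close>, under
  the differentials of the left translations by elements of \<open>\<Gamma>\<close>. As these translations are
  isometries, the unit tangent bundle of \<open>\<Gamma>\N\<close> is the quotient of that of \<open>N\<close>.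
\<close>

definition quotient_tangent ::
    "('a::euclidean_space) monoid \<Rightarrow> 'a set \<Rightarrow> 'a \<times> 'a \<Rightarrow> ('a \<times> 'a) set" where
  "quotient_tangent N \<Gamma> = (\<lambda>(p, u). (\<lambda>a. (a \<otimes>\<^bsub>N\<^esub> p, left_diff N a p u)) ` \<Gamma>)"

definition unit_tangent_bundle :: "('a::euclidean_space) monoid \<Rightarrow> ('a \<times> 'a) set" where
  "unit_tangent_bundle N = {(p, u). left_invariant_metric N p u u = 1}"

definition quotient_unit_tangent_bundle ::
    "('a::euclidean_space) monoid \<Rightarrow> 'a set \<Rightarrow> ('a \<times> 'a) set topology" where
  "quotient_unit_tangent_bundle N \<Gamma> =
     quotient_topology (top_of_set (unit_tangent_bundle N)) (quotient_tangent N \<Gamma>)"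

text \<open>
  Since \<open>N \<rightarrow> \<Gamma>\N\<close> is a local isometry, geodesics and velocity vectors of curves in \<open>\<Gamma>\N\<close> are
  computed from local lifts.
\<close>

definition quotient_geodesic ::
    "('a::euclidean_space) monoid \<Rightarrow> 'a set \<Rightarrow> (real \<Rightarrow> 'a set) \<Rightarrow> bool" where
  "quotient_geodesic N \<Gamma> c \<longleftrightarrow>
     (\<forall>t. \<exists>\<epsilon>>0. \<exists>\<gamma>. geodesic_on (left_invariant_metric N) \<gamma> {t - \<epsilon><..<t + \<epsilon>}
        \<and> (\<forall>s\<in>{t - \<epsilon><..<t + \<epsilon>}. c s = quotient_point N \<Gamma> (\<gamma> s)))"

definition has_quotient_velocity ::
    "('a::euclidean_space) monoid \<Rightarrow> 'a set \<Rightarrow> (real \<Rightarrow> 'a set) \<Rightarrow> ('a \<times> 'a) set \<Rightarrow> real \<Rightarrow> bool" where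
  "has_quotient_velocity N \<Gamma> c \<xi> t \<longleftrightarrow>
     (\<exists>\<gamma> u. (\<forall>\<^sub>F s in nhds t. c s = quotient_point N \<Gamma> (\<gamma> s))
        \<and> (\<gamma> has_vector_derivative u) (at t) \<and> \<xi> = quotient_tangent N \<Gamma> (\<gamma> t, u))"

text \<open>Geodesics are parametrized by all of \<open>\<real>\<close>; smoothly closed ones are the periodic ones.\<close>

definition closed_quotient_geodesic ::
    "('a::euclidean_space) monoid \<Rightarrow> 'a set \<Rightarrow> (real \<Rightarrow> 'a set) \<Rightarrow> bool" where
  "closed_quotient_geodesic N \<Gamma> c \<longleftrightarrow>
     quotient_geodesic N \<Gamma> c \<and> (\<exists>\<omega>>0. \<forall>t. c (t + \<omega>) = c t)"

definition density_of_closed_geodesics :: "('a::euclidean_space) monoid \<Rightarrow> 'a set \<Rightarrow> bool" where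
  "density_of_closed_geodesics N \<Gamma> \<longleftrightarrow>
     quotient_unit_tangent_bundle N \<Gamma> closure_of
       {\<xi> \<in> topspace (quotient_unit_tangent_bundle N \<Gamma>).
          \<exists>c t. closed_quotient_geodesic N \<Gamma> c \<and> has_quotient_velocity N \<Gamma> c \<xi> t}
     = topspace (quotient_unit_tangent_bundle N \<Gamma>)"


section \<open>The left invariant structure of the graph group\<close>

lemma graph_bracket_has_derivative:
  "((\<lambda>q. graph_bracket G q v) has_derivative (\<lambda>h. graph_bracket G h v)) F"
  "((\<lambda>q. graph_bracket G v q) has_derivative (\<lambda>h. graph_bracket G v h)) F"
  using bilinear_graph_bracket[of G] unfolding bilinear_def
  by (blast intro: bounded_linear_imp_has_derivative linear_conv_bounded_linear[THEN iffD1])+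

lemma left_diff_graph_group: "left_diff (graph_group G) a p u = u + (1/2) *\<^sub>R graph_bracket G a u"
proof -
  have "((\<lambda>q. a \<otimes>\<^bsub>graph_group G\<^esub> q) has_derivative (\<lambda>u. u + (1/2) *\<^sub>R graph_bracket G a u)) (at p)"
    unfolding mult_graph_group
    by (auto intro!: derivative_eq_intros graph_bracket_has_derivative)
  then show ?thesis
    unfolding left_diff_def by (simp add: frechet_derivative_at[symmetric])
qed

lemma left_invariant_metric_graph_group:
  "left_invariant_metric (graph_group G) p u v =
     (u - (1/2) *\<^sub>R graph_bracket G p u) \<bullet> (v - (1/2) *\<^sub>R graph_bracket G p v)"
  by (simp add: left_invariant_metric_def left_diff_graph_group inv_graph_group
      graph_bracket_bilinear_simps)

lemma left_translation_isometry:
  "left_invariant_metric (graph_group G) (a \<otimes>\<^bsub>graph_group G\<^esub> p)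
     (left_diff (graph_group G) a p u) (left_diff (graph_group G) a p v)
   = left_invariant_metric (graph_group G) p u v"
  by (simp add: left_invariant_metric_graph_group left_diff_graph_group mult_graph_group
      graph_bracket_bilinear_simps algebra_simps)

text \<open>
  The Lie algebra of \<open>graph_group G\<close>: the vector field \<open>\<lambda>p. left_diff (graph_group G) p 0 u\<close> is the
  left invariant one with value \<open>u\<close> at the identity, and the commutator \<open>DY(X) - DX(Y)\<close> of two such
  fields is the one belonging to the bracket of their values at the identity.
\<close>

lemma left_invariant_fields_bracket:
  defines "X \<equiv> \<lambda>G u p. left_diff (graph_group G) p 0 u"
  shows "frechet_derivative (X G v) (at p) (X G u p) - frechet_derivative (X G u) (at p) (X G v p)
    = X G (graph_bracket G u v) p"
proof -
  have "(X G v has_derivative (\<lambda>h. (1/2) *\<^sub>R graph_bracket G h v)) (at p)" for v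
    unfolding X_def left_diff_graph_group
    by (auto intro!: derivative_eq_intros graph_bracket_has_derivative)
  then have D: "frechet_derivative (X G v) (at p) = (\<lambda>h. (1/2) *\<^sub>R graph_bracket G h v)" for v
    using frechet_derivative_at by metis
  have "(1/2) *\<^sub>R graph_bracket G u v - (1/2) *\<^sub>R graph_bracket G v u = graph_bracket G u v"
    by (simp add: graph_bracket_skew[of G v u] flip: scaleR_add_left)
  then show ?thesis
    unfolding D by (simp add: X_def left_diff_graph_group graph_bracket_bilinear_simps)
qed

end

theory Submission
  imports Defs
begin

text \<open>
  Identify tangent vectors with elements \<open>(X, Z)\<close> of the Lie algebra by left translation, and let
  \<open>J(Z)\<close> be the skew map with \<open>\<langle>J(Z) x, y\<rangle> = \<langle>[x, y], Z\<rangle>\<close>. Along a geodesic the central part \<open>Z\<close> of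
  the velocity is constant, and the other part solves \<open>X' = J(Z) X\<close>. Suppose that \<open>X = X1 + X2\<close> with
  \<open>J(Z)^2 Xi = -\<theta>i^2 Xi\<close> and that \<open>\<omega>\<close> is a common period of the two rotations. Then the vertex
  coordinates of the geodesic have period \<open>\<omega>\<close>, and its edge coordinates grow in one period by \<open>\<omega> Y\<close>,
  where the drift \<open>Y = Z + ([X1, J(Z) X1]/\<theta>1^2 + [X2, J(Z) X2]/\<theta>2^2) / 2\<close> is the average of their
  derivative. Since \<open>\<omega> Y\<close> is central, the geodesic closes up in the quotient as soon as
  \<open>\<omega> Y \<in> \<Gamma>\<close>, whatever its starting point is (\<open>closed_geodesic_of_resonant_vector\<close>). Call such
  vectors \<open>(X, Z)\<close> resonant. The density property follows once they are dense in the Lie algebra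
  (\<open>density_from_resonant_vectors\<close>).

  Compactness of the quotient makes the projection of \<open>\<Gamma>\<close> to the vertex coordinates span, and
  commutators of elements of \<open>\<Gamma>\<close> are brackets of their projections. Hence the central part of \<open>\<Gamma>\<close>
  spans the space of edges, and the vectors with a positive integral multiple in \<open>\<Gamma>\<close>, after division
  by \<open>2\<pi>\<close>, are dense there (\<open>closure_resonant_directions\<close>).

  With four vertices, \<open>J(Z)\<close> is a skew \<open>4 \<times> 4\<close> matrix, so \<open>J^4 + |Z|^2 J^2 + Pf(Z)^2 = 0\<close> and the
  frequencies satisfy \<open>(\<theta>1 \<plusminus> \<theta>2)^2 = |Z|^2 \<plusminus> 2 Pf(Z)\<close>. The quadratic form \<open>2 Pf\<close> belongs to the
  self-adjoint operator \<open>S\<close> on the edge space that exchanges opposite edges up to sign (the Hodge star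
  compressed to the edges that are present). It satisfies \<open>S^3 = S\<close>, which splits \<open>Z\<close> into
  eigencomponents \<open>Z+\<close>, \<open>Z-\<close>, \<open>Z0\<close>, and then
  \<open>(\<theta>1 + \<theta>2)^2 = 2|Z+|^2 + |Z0|^2\<close>, \<open>(\<theta>1 - \<theta>2)^2 = 2|Z-|^2 + |Z0|^2\<close>. The drift is
  \<open>Y = u Z+ + v Z- + (u + v)/2 Z0\<close>, where the pair \<open>(u, v)\<close> is an affine image of \<open>(|X1|^2, |X2|^2)\<close>
  (\<open>closing_translation_eigenvectors\<close>).

  This can be read backwards. Near a generic vector \<open>(X, Z)\<close> with data \<open>(Y, u, v)\<close>, any triple close to
  \<open>(Y, u, v)\<close> comes from a vector close to \<open>(X, Z)\<close>: the formula for \<open>Y\<close> gives \<open>Z\<close>, and the lengths of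
  the \<open>Xi\<close> are adjusted to match \<open>u\<close> and \<open>v\<close> (\<open>closing_vector_perturbation\<close>). So \<open>Y\<close> may be taken
  in the dense set of good directions, and then \<open>u\<close>, \<open>v\<close> such that \<open>\<theta>1\<close> and \<open>\<theta>2\<close> are rational
  (\<open>exists_rational_frequencies\<close>). A perfect matching in the graph supplies a pair of opposite
  edges, so that \<open>Z+\<close>, \<open>Z-\<close> and \<open>Pf(Z)\<close> are nonzero for generic \<open>Z\<close>. Each of the five graphs has one.
\<close>

section \<open>Bracket, skew maps and geodesics\<close>

definition edge_bracket ::
    "('v::finite, 'e::finite) pre_digraph \<Rightarrow> real ^ 'v \<Rightarrow> real ^ 'v \<Rightarrow> real ^ 'e" where
  "edge_bracket G x y = (\<chi> e. x $ tail G e * y $ head G e - x $ head G e * y $ tail G e)"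

text \<open>
  The map \<open>J(z)\<close>, the transpose of the bracket in its second argument; \<open>inner_skew_map\<close> is the
  coordinate-free description.
\<close>
definition skew_map ::
    "('v::finite, 'e::finite) pre_digraph \<Rightarrow> real ^ 'e \<Rightarrow> real ^ 'v \<Rightarrow> real ^ 'v" where
  "skew_map G z x = (\<chi> i. edge_bracket G x (axis i 1) \<bullet> z)"

lemma graph_bracket_eq: "graph_bracket G p q = (0, edge_bracket G (fst p) (fst q))"
  by (simp add: graph_bracket_def edge_bracket_def)

lemma bounded_bilinear_edge_bracket: "bounded_bilinear (edge_bracket G)"
proof -
  have "bilinear (edge_bracket G)"
    unfolding bilinear_def edge_bracket_def
    by (auto intro!: linearI simp: vec_eq_iff algebra_simps)
  then show ?thesis by (simp add: bilinear_conv_bounded_bilinear)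
qed

lemmas edge_bracket_simps =
  bounded_bilinear.add_left[OF bounded_bilinear_edge_bracket]
  bounded_bilinear.add_right[OF bounded_bilinear_edge_bracket]
  bounded_bilinear.diff_left[OF bounded_bilinear_edge_bracket]
  bounded_bilinear.diff_right[OF bounded_bilinear_edge_bracket]
  bounded_bilinear.minus_left[OF bounded_bilinear_edge_bracket]
  bounded_bilinear.minus_right[OF bounded_bilinear_edge_bracket]
  bounded_bilinear.scaleR_left[OF bounded_bilinear_edge_bracket]
  bounded_bilinear.scaleR_right[OF bounded_bilinear_edge_bracket]

lemma edge_bracket_zero [simp]: "edge_bracket G 0 y = 0" "edge_bracket G x 0 = 0"
  by (simp_all add: edge_bracket_def vec_eq_iff)

lemma edge_bracket_self [simp]: "edge_bracket G x x = 0"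
  by (simp add: edge_bracket_def vec_eq_iff)

lemma edge_bracket_commute: "edge_bracket G y x = - edge_bracket G x y"
  by (simp add: edge_bracket_def vec_eq_iff)

lemma bounded_bilinear_skew_map: "bounded_bilinear (skew_map G)"
proof -
  have "bilinear (skew_map G)"
    unfolding bilinear_def skew_map_def
    by (auto intro!: linearI simp: vec_eq_iff edge_bracket_simps inner_add_left inner_add_right)
  then show ?thesis by (simp add: bilinear_conv_bounded_bilinear)
qed

lemmas skew_map_simps =
  bounded_bilinear.add_left[OF bounded_bilinear_skew_map]
  bounded_bilinear.add_right[OF bounded_bilinear_skew_map]
  bounded_bilinear.diff_left[OF bounded_bilinear_skew_map]
  bounded_bilinear.diff_right[OF bounded_bilinear_skew_map]
  bounded_bilinear.minus_left[OF bounded_bilinear_skew_map]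
  bounded_bilinear.minus_right[OF bounded_bilinear_skew_map]
  bounded_bilinear.scaleR_left[OF bounded_bilinear_skew_map]
  bounded_bilinear.scaleR_right[OF bounded_bilinear_skew_map]

lemma inner_skew_map: "skew_map G z x \<bullet> y = edge_bracket G x y \<bullet> z"
proof -
  interpret bounded_bilinear "edge_bracket G" by (rule bounded_bilinear_edge_bracket)
  have "edge_bracket G x y = edge_bracket G x (\<Sum>i\<in>UNIV. y $ i *\<^sub>R axis i 1)"
    by (simp add: basis_expansion[of y, unfolded scalar_mult_eq_scaleR])
  also have "\<dots> = (\<Sum>i\<in>UNIV. y $ i *\<^sub>R edge_bracket G x (axis i 1))"
    by (simp add: sum_right scaleR_right)
  finally show ?thesis
    by (simp add: skew_map_def inner_vec_def[of "_ :: real^'a"] inner_sum_left mult.commute)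
qed

text \<open>
  Differentiating the metric only hits the bracket terms, which are linear in the base point. The
  quadratic dependence on \<open>p\<close> therefore collapses to the left invariant form of the Levi-Civita
  connection, \<open>\<langle>\<nabla>_u u, w\<rangle> = -\<langle>[u, w], u\<rangle>\<close>.
\<close>
lemma christoffel_graph_group:
  "christoffel (left_invariant_metric (graph_group G)) p u u w =
     - (graph_bracket G u w \<bullet> (u - (1/2) *\<^sub>R graph_bracket G p u))"
proof -
  have "((\<lambda>q. left_invariant_metric (graph_group G) q v w) has_derivative
      (\<lambda>h. (v - (1/2) *\<^sub>R graph_bracket G p v) \<bullet> (- (1/2) *\<^sub>R graph_bracket G h w)
         + (- (1/2) *\<^sub>R graph_bracket G h v) \<bullet> (w - (1/2) *\<^sub>R graph_bracket G p w))) (at p)" for v w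
    unfolding left_invariant_metric_graph_group
    by (auto intro!: derivative_eq_intros graph_bracket_has_derivative)
  then have D: "frechet_derivative (\<lambda>q. left_invariant_metric (graph_group G) q v w) (at p) =
      (\<lambda>h. (v - (1/2) *\<^sub>R graph_bracket G p v) \<bullet> (- (1/2) *\<^sub>R graph_bracket G h w)
         + (- (1/2) *\<^sub>R graph_bracket G h v) \<bullet> (w - (1/2) *\<^sub>R graph_bracket G p w))" for v w
    by (rule frechet_derivative_at[symmetric])
  show ?thesis
    unfolding christoffel_def D
    by (simp add: graph_bracket_skew[of G w u] inner_commute field_simps)
qed

lemmas has_vector_derivative_fst = bounded_linear.has_vector_derivative[OF bounded_linear_fst]
lemmas has_vector_derivative_snd = bounded_linear.has_vector_derivative[OF bounded_linear_snd]

text \<open>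
  These are the geodesic equations in left trivialized form: \<open>Z\<close> is the constant central part of the
  velocity, and the bracket term in the first equation is the correction of the left translation.
\<close>
lemma geodesic_on_graph_group:
  assumes "\<And>t. (\<gamma> has_vector_derivative \<gamma>' t) (at t)"
    and "\<And>t. (\<gamma>' has_vector_derivative \<gamma>'' t) (at t)"
    and z: "\<And>t. snd (\<gamma>' t) = Z + (1/2) *\<^sub>R edge_bracket G (fst (\<gamma> t)) (fst (\<gamma>' t))"
    and x: "\<And>t. fst (\<gamma>'' t) = skew_map G Z (fst (\<gamma>' t))"
  shows "geodesic_on (left_invariant_metric (graph_group G)) \<gamma> T"
proof -
  have fst': "(fst \<circ> \<gamma> has_vector_derivative fst (\<gamma>' t)) (at t)"
    "(fst \<circ> \<gamma>' has_vector_derivative fst (\<gamma>'' t)) (at t)" for t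
    using assms(1,2)[of t] by (simp_all add: o_def has_vector_derivative_fst)
  have z': "snd (\<gamma>'' t) = (1/2) *\<^sub>R edge_bracket G (fst (\<gamma> t)) (fst (\<gamma>'' t))" for t
  proof -
    have "((\<lambda>t. Z + (1/2) *\<^sub>R edge_bracket G (fst (\<gamma> t)) (fst (\<gamma>' t))) has_vector_derivative
       (1/2) *\<^sub>R edge_bracket G (fst (\<gamma> t)) (fst (\<gamma>'' t))) (at t)"
      using bounded_bilinear.has_vector_derivative[OF bounded_bilinear_edge_bracket fst'[of t]]
      by (auto intro!: derivative_eq_intros simp: o_def)
    moreover have "(\<lambda>t. Z + (1/2) *\<^sub>R edge_bracket G (fst (\<gamma> t)) (fst (\<gamma>' t))) = (\<lambda>t. snd (\<gamma>' t))"
      using z by auto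
    moreover have "((\<lambda>t. snd (\<gamma>' t)) has_vector_derivative snd (\<gamma>'' t)) (at t)"
      using assms(2)[of t] by (rule has_vector_derivative_snd)
    ultimately show ?thesis
      by (simp add: vector_derivative_unique_at)
  qed
  have "left_invariant_metric (graph_group G) (\<gamma> t) (\<gamma>'' t) w
      + christoffel (left_invariant_metric (graph_group G)) (\<gamma> t) (\<gamma>' t) (\<gamma>' t) w = 0" for t w
    unfolding christoffel_graph_group left_invariant_metric_graph_group
    by (cases w) (simp add: graph_bracket_eq inner_prod_def z z' x inner_skew_map)
  with assms(1,2) show ?thesis
    unfolding geodesic_on_def by blast
qed

section \<open>Closed geodesics with two commensurable frequencies\<close>

text \<open>
  The curve \<open>exp(t J(Z)) X\<close> for an eigenvector \<open>X\<close> of \<open>J(Z)^2\<close> with eigenvalue \<open>-\<theta>^2\<close>.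
\<close>
definition eigen_orbit ::
    "('v::finite, 'e::finite) pre_digraph \<Rightarrow> real ^ 'e \<Rightarrow> real \<Rightarrow> real ^ 'v \<Rightarrow> real \<Rightarrow> real ^ 'v" where
  "eigen_orbit G Z \<theta> X t = cos (\<theta> * t) *\<^sub>R X + (sin (\<theta> * t) / \<theta>) *\<^sub>R skew_map G Z X"

context
  fixes G :: "('v::finite, 'e::finite) pre_digraph" and Z :: "real ^ 'e"
    and \<theta> :: real and X :: "real ^ 'v"
  assumes nz: "\<theta> \<noteq> 0" and eigen: "skew_map G Z (skew_map G Z X) = - (\<theta>\<^sup>2) *\<^sub>R X"
begin

lemma skew_map_eigen_orbit:
  "skew_map G Z (eigen_orbit G Z \<theta> X t) =
     cos (\<theta> * t) *\<^sub>R skew_map G Z X - (\<theta> * sin (\<theta> * t)) *\<^sub>R X"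
  using nz by (simp add: eigen_orbit_def skew_map_simps eigen power2_eq_square)

lemma eigen_orbit_derivative:
  "(eigen_orbit G Z \<theta> X has_vector_derivative skew_map G Z (eigen_orbit G Z \<theta> X t)) (at t)"
proof -
  have "((\<lambda>t. cos (\<theta> * t) *\<^sub>R X + (sin (\<theta> * t) / \<theta>) *\<^sub>R skew_map G Z X) has_vector_derivative
     (- sin (\<theta> * t) * \<theta>) *\<^sub>R X + (cos (\<theta> * t) * \<theta> / \<theta>) *\<^sub>R skew_map G Z X) (at t)"
    by (auto intro!: derivative_eq_intros simp: nz)
  moreover have "skew_map G Z (eigen_orbit G Z \<theta> X t) =
      (- sin (\<theta> * t) * \<theta>) *\<^sub>R X + (cos (\<theta> * t) * \<theta> / \<theta>) *\<^sub>R skew_map G Z X"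
    using nz by (simp add: skew_map_eigen_orbit)
  ultimately show ?thesis
    by (simp only: eigen_orbit_def[abs_def])
qed

lemma skew_map_eigen_orbit_derivative:
  "((\<lambda>t. skew_map G Z (eigen_orbit G Z \<theta> X t)) has_vector_derivative
     - (\<theta>\<^sup>2) *\<^sub>R eigen_orbit G Z \<theta> X t) (at t)"
proof -
  have "((\<lambda>t. cos (\<theta> * t) *\<^sub>R skew_map G Z X - (\<theta> * sin (\<theta> * t)) *\<^sub>R X) has_vector_derivative
     (- sin (\<theta> * t) * \<theta>) *\<^sub>R skew_map G Z X - (\<theta> * (cos (\<theta> * t) * \<theta>)) *\<^sub>R X) (at t)"
    by (auto intro!: derivative_eq_intros)
  moreover have "- (\<theta>\<^sup>2) *\<^sub>R eigen_orbit G Z \<theta> X t =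
      (- sin (\<theta> * t) * \<theta>) *\<^sub>R skew_map G Z X - (\<theta> * (cos (\<theta> * t) * \<theta>)) *\<^sub>R X"
    using nz by (simp add: eigen_orbit_def power2_eq_square algebra_simps)
  ultimately show ?thesis
    by (simp only: skew_map_eigen_orbit)
qed

text \<open>
  The rotation by \<open>exp(t J(Z))\<close> preserves the oriented area element of the plane spanned by \<open>X\<close> and
  \<open>J(Z) X\<close>. This constant term is what makes the geodesic drift.
\<close>
lemma edge_bracket_eigen_orbit:
  "edge_bracket G (eigen_orbit G Z \<theta> X t) (skew_map G Z (eigen_orbit G Z \<theta> X t))
     = edge_bracket G X (skew_map G Z X)"
proof -
  have "edge_bracket G (eigen_orbit G Z \<theta> X t) (skew_map G Z (eigen_orbit G Z \<theta> X t))
     = ((cos (\<theta> * t))\<^sup>2 + (sin (\<theta> * t))\<^sup>2) *\<^sub>R edge_bracket G X (skew_map G Z X)"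
    unfolding skew_map_eigen_orbit unfolding eigen_orbit_def
    using nz by (simp add: edge_bracket_simps edge_bracket_commute[of G "skew_map G Z X" X]
        power2_eq_square scaleR_add_left scaleR_diff_right)
       (simp flip: scaleR_add_left power2_eq_square)
  then show ?thesis by simp
qed

lemma eigen_orbit_periodic:
  assumes "\<theta> * \<omega> = 2 * pi * of_int k"
  shows "eigen_orbit G Z \<theta> X (t + \<omega>) = eigen_orbit G Z \<theta> X t"
proof -
  have "sin (\<theta> * (t + \<omega>)) = sin (\<theta> * t)" "cos (\<theta> * (t + \<omega>)) = cos (\<theta> * t)"
    using sin_int_2pin[of k] cos_int_2pin[of k]
    by (simp_all add: distrib_left assms sin_add cos_add)
  then show ?thesis by (simp add: eigen_orbit_def)
qed

end

text \<open>
  The drift: the mean rate of change of the edge coordinates along the geodesic with initial velocity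
  \<open>(X1 + X2, Z)\<close>.
\<close>
definition closing_translation ::
    "('v::finite, 'e::finite) pre_digraph \<Rightarrow> real ^ 'e \<Rightarrow> real \<Rightarrow> real \<Rightarrow> real ^ 'v \<Rightarrow> real ^ 'v \<Rightarrow> real ^ 'e"
  where "closing_translation G Z \<theta>1 \<theta>2 X1 X2 =
    Z + (1/2) *\<^sub>R ((1 / \<theta>1\<^sup>2) *\<^sub>R edge_bracket G X1 (skew_map G Z X1)
       + (1 / \<theta>2\<^sup>2) *\<^sub>R edge_bracket G X2 (skew_map G Z X2))"

text \<open>
  The mixed terms \<open>[J A1, A2]\<close> and \<open>[A1, J A2]\<close> in the velocity of the edge coordinates have a periodic
  primitive in the span of \<open>[A1, A2]\<close> and \<open>[J A1, J A2]\<close>, because \<open>J \<otimes> 1 + 1 \<otimes> J\<close> has the inverse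
  \<open>(1 \<otimes> J - J \<otimes> 1) / (\<theta>1^2 - \<theta>2^2)\<close> on a product of two eigenspaces. Here \<open>a\<close> and \<open>b\<close> stand for the two
  mixed terms, and the identity verifies the coefficients of this primitive.
\<close>
lemma oscillating_drift_coefficients:
  fixes a b :: "'a :: real_vector"
  assumes "\<theta>1 \<noteq> 0" "\<theta>2 \<noteq> 0" "\<theta>1\<^sup>2 \<noteq> \<theta>2\<^sup>2"
  shows "(1 / (2 * (\<theta>1\<^sup>2 - \<theta>2\<^sup>2))) *\<^sub>R (2 *\<^sub>R (a + b)
      + (1 / \<theta>1\<^sup>2 + 1 / \<theta>2\<^sup>2) *\<^sub>R (- (\<theta>1\<^sup>2) *\<^sub>R b - (\<theta>2\<^sup>2) *\<^sub>R a))
    = (1/2) *\<^sub>R ((1 / \<theta>1\<^sup>2) *\<^sub>R a - (1 / \<theta>2\<^sup>2) *\<^sub>R b)"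
proof -
  have "(1 / (2 * (\<theta>1\<^sup>2 - \<theta>2\<^sup>2))) * (2 - (1 / \<theta>1\<^sup>2 + 1 / \<theta>2\<^sup>2) * \<theta>2\<^sup>2) = (1/2) * (1 / \<theta>1\<^sup>2)"
    "(1 / (2 * (\<theta>1\<^sup>2 - \<theta>2\<^sup>2))) * (2 - (1 / \<theta>1\<^sup>2 + 1 / \<theta>2\<^sup>2) * \<theta>1\<^sup>2) = - ((1/2) * (1 / \<theta>2\<^sup>2))"
    using assms by (simp_all add: divide_simps) (simp_all add: algebra_simps)?
  moreover have "(1 / (2 * (\<theta>1\<^sup>2 - \<theta>2\<^sup>2))) *\<^sub>R (2 *\<^sub>R (a + b)
      + (1 / \<theta>1\<^sup>2 + 1 / \<theta>2\<^sup>2) *\<^sub>R (- (\<theta>1\<^sup>2) *\<^sub>R b - (\<theta>2\<^sup>2) *\<^sub>R a))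
    = ((1 / (2 * (\<theta>1\<^sup>2 - \<theta>2\<^sup>2))) * (2 - (1 / \<theta>1\<^sup>2 + 1 / \<theta>2\<^sup>2) * \<theta>2\<^sup>2)) *\<^sub>R a
    + ((1 / (2 * (\<theta>1\<^sup>2 - \<theta>2\<^sup>2))) * (2 - (1 / \<theta>1\<^sup>2 + 1 / \<theta>2\<^sup>2) * \<theta>1\<^sup>2)) *\<^sub>R b"
    by (simp only: scaleR_scaleR[symmetric] scaleR_left_diff_distrib scaleR_add_right
        scaleR_diff_right scaleR_minus_left scaleR_minus_right) simp
  ultimately show ?thesis by (simp add: scaleR_diff_right)
qed


lemma quotient_point_lattice_mult:
  assumes "subgroup \<Gamma> (graph_group G)" "h \<in> \<Gamma>"
  shows "quotient_point (graph_group G) \<Gamma> (h \<otimes>\<^bsub>graph_group G\<^esub> x) = quotient_point (graph_group G) \<Gamma> x"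
proof -
  interpret group "graph_group G" by (rule group_graph_group)
  have "\<Gamma> #>\<^bsub>graph_group G\<^esub> (h \<otimes>\<^bsub>graph_group G\<^esub> x)
      = (\<Gamma> #>\<^bsub>graph_group G\<^esub> h) #>\<^bsub>graph_group G\<^esub> x"
    by (simp add: coset_mult_assoc)
  then show ?thesis
    using coset_join2[of h \<Gamma>] assms by simp
qed

text \<open>
  The geodesic is written down explicitly as a left translate of a curve \<open>\<sigma>\<close> whose edge part is linear
  growth along the drift plus a periodic term. Left multiplication by a central element is translation
  of the edge coordinates, so \<open>\<sigma>\<close>, and with it every left translate, is shifted by the same element of
  \<open>\<Gamma>\<close> after one period.
\<close>
lemma closed_geodesic_of_resonant_vector:
  fixes G :: "('v::finite, 'e::finite) pre_digraph" and p :: "(real ^ 'v) \<times> (real ^ 'e)"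
  assumes \<theta>: "\<theta>1 \<noteq> 0" "\<theta>2 \<noteq> 0" "\<theta>1\<^sup>2 \<noteq> \<theta>2\<^sup>2"
    and X1: "skew_map G Z (skew_map G Z X1) = - (\<theta>1\<^sup>2) *\<^sub>R X1"
    and X2: "skew_map G Z (skew_map G Z X2) = - (\<theta>2\<^sup>2) *\<^sub>R X2"
    and \<omega>: "\<omega> > 0" "\<theta>1 * \<omega> = 2 * pi * of_int k1" "\<theta>2 * \<omega> = 2 * pi * of_int k2"
    and \<Gamma>: "subgroup \<Gamma> (graph_group G)" "(0, \<omega> *\<^sub>R closing_translation G Z \<theta>1 \<theta>2 X1 X2) \<in> \<Gamma>"
  shows "\<exists>c. closed_quotient_geodesic (graph_group G) \<Gamma> c \<and>
    has_quotient_velocity (graph_group G) \<Gamma> c (quotient_tangent (graph_group G) \<Gamma>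
      (p, left_diff (graph_group G) p 0 (X1 + X2, Z))) 0"
proof -
  define J where "J = skew_map G Z"
  define A1 A2 where "A1 = eigen_orbit G Z \<theta>1 X1" and "A2 = eigen_orbit G Z \<theta>2 X2"
  define Y where "Y = closing_translation G Z \<theta>1 \<theta>2 X1 X2"
  define D where "D = 1 / (2 * (\<theta>1\<^sup>2 - \<theta>2\<^sup>2))"
  define x where "x t = - ((1 / \<theta>1\<^sup>2) *\<^sub>R J (A1 t)) - (1 / \<theta>2\<^sup>2) *\<^sub>R J (A2 t)" for t
  \<comment> \<open>the periodic primitive of the difference between the drift and the velocity of the edge coordinates\<close>
  define per where "per t = D *\<^sub>R (2 *\<^sub>R edge_bracket G (A1 t) (A2 t)
    + (1 / \<theta>1\<^sup>2 + 1 / \<theta>2\<^sup>2) *\<^sub>R edge_bracket G (J (A1 t)) (J (A2 t)))" for t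
  define \<sigma> where "\<sigma> t = (x t, t *\<^sub>R Y - per t)" for t
  have A': "(A1 has_vector_derivative J (A1 t)) (at t)" "(A2 has_vector_derivative J (A2 t)) (at t)"
    "((\<lambda>t. J (A1 t)) has_vector_derivative - (\<theta>1\<^sup>2) *\<^sub>R A1 t) (at t)"
    "((\<lambda>t. J (A2 t)) has_vector_derivative - (\<theta>2\<^sup>2) *\<^sub>R A2 t) (at t)" for t
    unfolding J_def A1_def A2_def
    using \<theta> X1 X2 by (blast intro: eigen_orbit_derivative skew_map_eigen_orbit_derivative)+
  have x': "(x has_vector_derivative A1 t + A2 t) (at t)" for t
    unfolding x_def
    by (auto intro!: derivative_eq_intros A' simp: \<theta>)
  define \<zeta> where "\<zeta> t = Z + (1/2) *\<^sub>R edge_bracket G (x t) (A1 t + A2 t)" for t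
  note br' = bounded_bilinear.has_vector_derivative[OF bounded_bilinear_edge_bracket]
  have per': "(per has_vector_derivative
     D *\<^sub>R (2 *\<^sub>R (edge_bracket G (J (A1 t)) (A2 t) + edge_bracket G (A1 t) (J (A2 t)))
      + (1 / \<theta>1\<^sup>2 + 1 / \<theta>2\<^sup>2) *\<^sub>R (- (\<theta>1\<^sup>2) *\<^sub>R edge_bracket G (A1 t) (J (A2 t))
         - (\<theta>2\<^sup>2) *\<^sub>R edge_bracket G (J (A1 t)) (A2 t)))) (at t)" for t
    unfolding per_def
    by (auto intro!: derivative_eq_intros br' A' simp: edge_bracket_simps algebra_simps)
  have Y: "Y = \<zeta> t + (1/2) *\<^sub>R ((1 / \<theta>1\<^sup>2) *\<^sub>R edge_bracket G (J (A1 t)) (A2 t)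
       - (1 / \<theta>2\<^sup>2) *\<^sub>R edge_bracket G (A1 t) (J (A2 t)))" for t
  proof -
    have "edge_bracket G (A1 t) (J (A1 t)) = edge_bracket G X1 (J X1)"
      "edge_bracket G (A2 t) (J (A2 t)) = edge_bracket G X2 (J X2)"
      unfolding J_def A1_def A2_def using \<theta> X1 X2 by (simp_all add: edge_bracket_eigen_orbit)
    then show ?thesis
      unfolding Y_def closing_translation_def \<zeta>_def x_def
      by (simp add: edge_bracket_simps edge_bracket_commute[of G "J (A1 t)" "A1 t"]
          edge_bracket_commute[of G "J (A2 t)" "A2 t"] edge_bracket_commute[of G "J (A2 t)" "A1 t"]
          scaleR_add_right scaleR_diff_right flip: J_def)
  qed
  have z': "((\<lambda>t. t *\<^sub>R Y - per t) has_vector_derivative \<zeta> t) (at t)" for t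
  proof -
    have "((\<lambda>t. t *\<^sub>R Y - per t) has_vector_derivative Y -
       (1/2) *\<^sub>R ((1 / \<theta>1\<^sup>2) *\<^sub>R edge_bracket G (J (A1 t)) (A2 t)
         - (1 / \<theta>2\<^sup>2) *\<^sub>R edge_bracket G (A1 t) (J (A2 t)))) (at t)"
      using per'[of t] unfolding D_def oscillating_drift_coefficients[OF \<theta>]
      by (auto intro!: derivative_eq_intros)
    then show ?thesis using Y[of t] by simp
  qed
  define \<sigma>' where "\<sigma>' t = (A1 t + A2 t, \<zeta> t)" for t
  define \<sigma>'' where "\<sigma>'' t = (J (A1 t) + J (A2 t),
     (1/2) *\<^sub>R edge_bracket G (x t) (J (A1 t) + J (A2 t)))" for t
  have \<sigma>': "(\<sigma> has_vector_derivative \<sigma>' t) (at t)" for t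
    unfolding \<sigma>_def \<sigma>'_def by (intro has_vector_derivative_Pair x' z')
  have \<sigma>'': "(\<sigma>' has_vector_derivative \<sigma>'' t) (at t)" for t
    unfolding \<sigma>'_def \<sigma>''_def \<zeta>_def
    by (auto intro!: derivative_eq_intros has_vector_derivative_Pair br' A' x')
  \<comment> \<open>this translate starts at \<open>p\<close>, as \<open>- \<sigma> 0\<close> is the inverse of \<open>\<sigma> 0\<close>\<close>
  define q where "q = p \<otimes>\<^bsub>graph_group G\<^esub> (- \<sigma> 0)"
  define \<gamma> where "\<gamma> t = q \<otimes>\<^bsub>graph_group G\<^esub> \<sigma> t" for t
  define \<gamma>' where "\<gamma>' t = \<sigma>' t + (1/2) *\<^sub>R graph_bracket G q (\<sigma>' t)" for t
  define \<gamma>'' where "\<gamma>'' t = \<sigma>'' t + (1/2) *\<^sub>R graph_bracket G q (\<sigma>'' t)" for t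
  have lin: "bounded_linear (graph_bracket G q)"
    using bilinear_graph_bracket[of G] unfolding bilinear_def linear_conv_bounded_linear by blast
  note lin' = bounded_linear.has_vector_derivative[OF lin]
  have \<gamma>': "(\<gamma> has_vector_derivative \<gamma>' t) (at t)" for t
    unfolding \<gamma>_def \<gamma>'_def mult_graph_group
    by (auto intro!: derivative_eq_intros \<sigma>' lin')
  have \<gamma>'': "(\<gamma>' has_vector_derivative \<gamma>'' t) (at t)" for t
    unfolding \<gamma>'_def \<gamma>''_def mult_graph_group
    by (auto intro!: derivative_eq_intros \<sigma>'' lin')
  have "snd (\<gamma>' t) = Z + (1/2) *\<^sub>R edge_bracket G (fst (\<gamma> t)) (fst (\<gamma>' t))" for t
    by (simp add: \<gamma>'_def \<gamma>_def \<sigma>_def \<sigma>'_def mult_graph_group graph_bracket_eq \<zeta>_def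
        edge_bracket_simps scaleR_add_right)
  moreover have "fst (\<gamma>'' t) = skew_map G Z (fst (\<gamma>' t))" for t
    by (simp add: \<gamma>'_def \<gamma>''_def \<sigma>'_def \<sigma>''_def graph_bracket_eq skew_map_simps J_def)
  ultimately have geodesic: "geodesic_on (left_invariant_metric (graph_group G)) \<gamma> T" for T
    using geodesic_on_graph_group[OF \<gamma>' \<gamma>''] by blast
  have "A1 (t + \<omega>) = A1 t" "A2 (t + \<omega>) = A2 t" for t
    unfolding A1_def A2_def using \<theta> X1 X2 \<omega> by (blast intro: eigen_orbit_periodic)+
  then have "\<sigma> (t + \<omega>) = \<sigma> t + (0, \<omega> *\<^sub>R Y)" for t
    by (simp add: \<sigma>_def x_def per_def scaleR_add_left)
  then have "\<gamma> (t + \<omega>) = (0, \<omega> *\<^sub>R Y) \<otimes>\<^bsub>graph_group G\<^esub> \<gamma> t" for t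
    by (simp add: \<gamma>_def mult_graph_group graph_bracket_eq edge_bracket_simps zero_prod_def)
  then have "quotient_point (graph_group G) \<Gamma> (\<gamma> (t + \<omega>)) = quotient_point (graph_group G) \<Gamma> (\<gamma> t)" for t
    using quotient_point_lattice_mult[OF \<Gamma>] by (simp add: Y_def)
  then have closed: "closed_quotient_geodesic (graph_group G) \<Gamma> (\<lambda>t. quotient_point (graph_group G) \<Gamma> (\<gamma> t))"
    unfolding closed_quotient_geodesic_def quotient_geodesic_def
    using geodesic \<omega>(1) by (metis zero_less_one)
  have \<gamma>0: "\<gamma> 0 = p"
    by (simp add: \<gamma>_def q_def mult_graph_group graph_bracket_eq edge_bracket_simps prod_eq_iff)
  have "\<sigma>' 0 - (1/2) *\<^sub>R graph_bracket G (\<sigma> 0) (\<sigma>' 0) = (X1 + X2, Z)"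
    by (simp add: \<sigma>'_def \<sigma>_def \<zeta>_def graph_bracket_eq A1_def A2_def eigen_orbit_def)
  then have "\<gamma>' 0 = left_diff (graph_group G) p 0 (X1 + X2, Z)"
    unfolding left_diff_graph_group \<gamma>'_def q_def
    by (auto simp: mult_graph_group graph_bracket_eq edge_bracket_simps prod_eq_iff algebra_simps)
  then have "has_quotient_velocity (graph_group G) \<Gamma> (\<lambda>t. quotient_point (graph_group G) \<Gamma> (\<gamma> t))
     (quotient_tangent (graph_group G) \<Gamma> (p, left_diff (graph_group G) p 0 (X1 + X2, Z))) 0"
    unfolding has_quotient_velocity_def using \<gamma>'[of 0] \<gamma>0
    by (intro exI[of _ \<gamma>] exI[of _ "\<gamma>' 0"]) auto
  with closed show ?thesis by blast
qed

section \<open>The central part of a lattice\<close>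

definition central_lattice :: "((real ^ 'v) \<times> (real ^ 'e)) set \<Rightarrow> (real ^ 'e) set" where
  "central_lattice \<Gamma> = {z. (0, z) \<in> \<Gamma>}"

lemma central_lattice_closed:
  fixes G :: "('v::finite, 'e::finite) pre_digraph"
  assumes "subgroup \<Gamma> (graph_group G)"
  shows "0 \<in> central_lattice \<Gamma>"
    and "y \<in> central_lattice \<Gamma> \<Longrightarrow> z \<in> central_lattice \<Gamma> \<Longrightarrow> y + z \<in> central_lattice \<Gamma>"
    and "z \<in> central_lattice \<Gamma> \<Longrightarrow> of_int k *\<^sub>R z \<in> central_lattice \<Gamma>"
proof -
  show zero: "0 \<in> central_lattice \<Gamma>"
    using subgroup.one_closed[OF assms] by (simp add: central_lattice_def zero_prod_def)
  show add: "y + z \<in> central_lattice \<Gamma>" if "y \<in> central_lattice \<Gamma>" "z \<in> central_lattice \<Gamma>" for y z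
    using subgroup.m_closed[OF assms, of "(0, y)" "(0, z)"] that
    by (simp add: central_lattice_def mult_graph_group)
  have minus: "- z \<in> central_lattice \<Gamma>" if "z \<in> central_lattice \<Gamma>" for z
    using subgroup.m_inv_closed[OF assms, of "(0, z)"] that
    by (simp add: central_lattice_def inv_graph_group)
  show "of_int k *\<^sub>R z \<in> central_lattice \<Gamma>" if "z \<in> central_lattice \<Gamma>"
  proof (induction k rule: int_induct[where k = 0])
    case base then show ?case using zero by simp
  next
    case (step1 i) then show ?case using add[OF _ that] by (simp add: scaleR_add_left)
  next
    case (step2 i) then show ?case using add[OF _ minus[OF that]] by (simp add: scaleR_diff_left)
  qed
qed

text \<open>
  In a two-step group the commutator of two elements is the exponential of their bracket.
\<close>
lemma edge_bracket_in_central_lattice: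
  fixes G :: "('v::finite, 'e::finite) pre_digraph"
  assumes "subgroup \<Gamma> (graph_group G)" "g \<in> \<Gamma>" "h \<in> \<Gamma>"
  shows "edge_bracket G (fst g) (fst h) \<in> central_lattice \<Gamma>"
proof -
  have "(g \<otimes>\<^bsub>graph_group G\<^esub> h) \<otimes>\<^bsub>graph_group G\<^esub>
      inv\<^bsub>graph_group G\<^esub> (h \<otimes>\<^bsub>graph_group G\<^esub> g) \<in> \<Gamma>"
    using assms by (simp add: subgroup.m_closed subgroup.m_inv_closed)
  moreover have "(g \<otimes>\<^bsub>graph_group G\<^esub> h) \<otimes>\<^bsub>graph_group G\<^esub>
      inv\<^bsub>graph_group G\<^esub> (h \<otimes>\<^bsub>graph_group G\<^esub> g) = (0, edge_bracket G (fst g) (fst h))"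
    unfolding inv_graph_group mult_graph_group graph_bracket_eq
    by (simp add: prod_eq_iff edge_bracket_simps edge_bracket_commute[of G "fst h" "fst g"]
        flip: scaleR_add_left)
  ultimately show ?thesis by (simp add: central_lattice_def)
qed

text \<open>
  A linear functional that vanishes on the projection of \<open>\<Gamma>\<close> to the vertex coordinates would descend to
  an unbounded continuous function on the compact quotient.
\<close>
lemma span_fst_lattice:
  fixes G :: "('v::finite, 'e::finite) pre_digraph"
  assumes \<Gamma>: "lattice_in (graph_group G) \<Gamma>"
  shows "span (fst ` \<Gamma>) = UNIV"
proof (rule ccontr)
  assume "span (fst ` \<Gamma>) \<noteq> UNIV"
  then obtain a where a: "a \<noteq> 0" "\<And>x. x \<in> span (fst ` \<Gamma>) \<Longrightarrow> a \<bullet> x = 0"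
    using span_not_UNIV_orthogonal by blast
  define Q where "Q = quotient_topology euclidean (quotient_point (graph_group G) \<Gamma>)"
  define U where "U n = {p :: (real ^ 'v) \<times> (real ^ 'e). \<bar>a \<bullet> fst p\<bar> < real n}" for n
  let ?\<pi> = "quotient_point (graph_group G) \<Gamma>"
  interpret group "graph_group G" by (rule group_graph_group)
  have sub: "subgroup \<Gamma> (graph_group G)" using \<Gamma> by (simp add: lattice_in_def)
  have inv: "a \<bullet> fst p = a \<bullet> fst q" if "?\<pi> p = ?\<pi> q" for p q
  proof -
    have "p \<in> ?\<pi> q" using rcos_self[OF _ sub, of p] that by simp
    then obtain h where "h \<in> \<Gamma>" "p = h \<otimes>\<^bsub>graph_group G\<^esub> q"
      by (auto simp: r_coset_def)
    then show ?thesis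
      using a(2)[OF span_base, of "fst h"]
      by (simp add: mult_graph_group graph_bracket_eq inner_add_right)
  qed
  have open_U: "open (U n)" for n
    unfolding U_def by (intro open_Collect_less continuous_intros)
  have pre: "{p. ?\<pi> p \<in> ?\<pi> ` U n} = U n" for n
  proof (intro equalityI subsetI)
    fix p assume "p \<in> {p. ?\<pi> p \<in> ?\<pi> ` U n}"
    then obtain r where "r \<in> U n" "?\<pi> p = ?\<pi> r" by blast
    then show "p \<in> U n" using inv[of p r] by (simp add: U_def)
  qed blast
  define C where "C = range (\<lambda>n. ?\<pi> ` U n)"
  have "openin Q (?\<pi> ` U n)" for n
    unfolding Q_def openin_quotient_topology by (simp add: pre open_U image_mono)
  then have C_open: "\<forall>W\<in>C. openin Q W" by (simp add: C_def)
  have C_cover: "topspace Q \<subseteq> \<Union>C"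
  proof -
    have "\<exists>n. p \<in> U n" for p
      unfolding U_def using reals_Archimedean2 by auto
    then have "?\<pi> p \<in> (\<Union>n. ?\<pi> ` U n)" for p by blast
    then show ?thesis by (auto simp: Q_def C_def)
  qed
  have "compact_space Q" using \<Gamma> by (simp add: lattice_in_def Q_def)
  from this[unfolded compact_space_alt, THEN spec, THEN mp, OF conjI[OF C_open C_cover]]
  obtain F where F: "finite F" "F \<subseteq> C" "topspace Q \<subseteq> \<Union>F"
    by (elim exE conjE) (rule that)
  from finite_subset_image[OF F(1) F(2)[unfolded C_def]]
  obtain N where N: "finite N" "F = (\<lambda>n. ?\<pi> ` U n) ` N" by (elim exE conjE) (rule that)
  define m where "m = Max (insert 0 N)"
  define p :: "(real ^ 'v) \<times> (real ^ 'e)" where "p = ((real m / (a \<bullet> a)) *\<^sub>R a, 0)"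
  have "?\<pi> p \<in> topspace Q" by (simp add: Q_def)
  then obtain n where n: "n \<in> N" "?\<pi> p \<in> ?\<pi> ` U n" using F(3) N(2) by blast
  then have "p \<in> U n" using pre[of n] by blast
  then have "real m < real n" using a(1) by (simp add: U_def p_def)
  moreover have "n \<le> m" unfolding m_def using N(1) n(1) by simp
  ultimately show False by simp
qed

lemma span_central_lattice:
  fixes G :: "('v::finite, 'e::finite) pre_digraph"
  assumes G: "simple_digraph G" "arcs G = UNIV" and \<Gamma>: "lattice_in (graph_group G) \<Gamma>"
  shows "span (central_lattice \<Gamma>) = UNIV"
proof -
  let ?S = "span (central_lattice \<Gamma>)"
  have sub: "subgroup \<Gamma> (graph_group G)" using \<Gamma> by (simp add: lattice_in_def)
  have lin: "subspace {y. edge_bracket G x y \<in> ?S}" "subspace {y. edge_bracket G y x \<in> ?S}" for x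
    unfolding subspace_def
    by (auto simp: edge_bracket_simps intro: span_zero span_add span_scale)
  have 1: "edge_bracket G x y \<in> ?S" if "x \<in> fst ` \<Gamma>" for x y
  proof -
    have "span (fst ` \<Gamma>) \<subseteq> {y. edge_bracket G x y \<in> ?S}"
      using that edge_bracket_in_central_lattice[OF sub]
      by (intro span_minimal lin) (auto intro: span_base)
    then show ?thesis using span_fst_lattice[OF \<Gamma>] by auto
  qed
  have "span (fst ` \<Gamma>) \<subseteq> {x. edge_bracket G x y \<in> ?S}" for y
    using 1 by (intro span_minimal lin) auto
  then have "edge_bracket G x y \<in> ?S" for x y
    using span_fst_lattice[OF \<Gamma>] by auto
  moreover have "axis e 1 = edge_bracket G (axis (tail G e) 1) (axis (head G e) 1)" for e
    using graph_bracket_arc[OF G, of e] by (simp add: graph_bracket_eq)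
  ultimately have "axis e 1 \<in> ?S" for e by metis
  then have "Basis \<subseteq> ?S" by (auto simp: Basis_vec_def)
  then show ?thesis
    using span_minimal[of Basis ?S] by auto
qed

text \<open>
  Two rational frequencies have a common period in \<open>2\<pi> \<nat>\<close>. If the drift lies in this set for the
  central part \<open>L\<close> of a lattice, a multiple of that period carries it into \<open>L\<close>.
\<close>
definition resonant_directions :: "'a::real_normed_vector set \<Rightarrow> 'a set" where
  "resonant_directions L = {y. \<exists>m::nat. m > 0 \<and> (2 * pi * real m) *\<^sub>R y \<in> L}"

text \<open>
  The set is a vector space over the rationals, so its closure is a real subspace, and that subspace
  contains \<open>L\<close>.
\<close>
lemma closure_resonant_directions:
  fixes L :: "'a::real_normed_vector set"
  assumes L: "0 \<in> L" "\<And>x y. x \<in> L \<Longrightarrow> y \<in> L \<Longrightarrow> x + y \<in> L"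
    "\<And>k x. x \<in> L \<Longrightarrow> of_int k *\<^sub>R x \<in> L" and span: "span L = UNIV"
  shows "closure (resonant_directions L) = UNIV"
proof -
  let ?D = "resonant_directions L"
  have L_nat: "real n *\<^sub>R x \<in> L" if "x \<in> L" for n x
    using L(3)[OF that, of "int n"] by simp
  have D0: "0 \<in> ?D" using L(1) by (auto simp: resonant_directions_def)
  have D_add: "x + y \<in> ?D" if xy: "x \<in> ?D" "y \<in> ?D" for x y
  proof -
    obtain m n :: nat where mn: "m > 0" "n > 0" "(2 * pi * real m) *\<^sub>R x \<in> L" "(2 * pi * real n) *\<^sub>R y \<in> L"
      using xy by (auto simp: resonant_directions_def)
    have "real n *\<^sub>R (2 * pi * real m) *\<^sub>R x + real m *\<^sub>R (2 * pi * real n) *\<^sub>R y \<in> L"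
      by (intro L L_nat mn)
    also have "real n *\<^sub>R (2 * pi * real m) *\<^sub>R x + real m *\<^sub>R (2 * pi * real n) *\<^sub>R y
       = (2 * pi * real (m * n)) *\<^sub>R (x + y)"
      by (simp add: scaleR_add_right mult_ac)
    finally show ?thesis using mn(1,2) unfolding resonant_directions_def
      by (intro CollectI exI[of _ "m * n"]) simp
  qed
  have D_rat: "q *\<^sub>R x \<in> ?D" if q: "q \<in> \<rat>" and x: "x \<in> ?D" for q x
  proof -
    obtain a b :: int where ab: "b > 0" "q = of_int a / of_int b"
      using q by (elim Rats_cases') (rule that)
    obtain m :: nat where m: "m > 0" "(2 * pi * real m) *\<^sub>R x \<in> L"
      using x by (auto simp: resonant_directions_def)
    have "of_int a *\<^sub>R (2 * pi * real m) *\<^sub>R x \<in> L" by (rule L(3)[OF m(2)])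
    also have "of_int a *\<^sub>R (2 * pi * real m) *\<^sub>R x = (2 * pi * real (m * nat b)) *\<^sub>R (q *\<^sub>R x)"
      using ab by (simp add: mult_ac)
    finally show ?thesis using m(1) ab(1) unfolding resonant_directions_def
      by (intro CollectI exI[of _ "m * nat b"]) simp
  qed
  have "subspace (closure ?D)"
    unfolding subspace_def
  proof (intro conjI ballI allI)
    show "0 \<in> closure ?D" using D0 closure_subset by blast
  next
    fix x y assume xy: "x \<in> closure ?D" "y \<in> closure ?D"
    obtain u where u: "\<forall>n. u n \<in> ?D" "u \<longlonglongrightarrow> x"
      using xy(1) unfolding closure_sequential by blast
    obtain v where v: "\<forall>n. v n \<in> ?D" "v \<longlonglongrightarrow> y"
      using xy(2) unfolding closure_sequential by blast
    have 1: "(\<lambda>n. u n + v n) \<longlonglongrightarrow> x + y"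
      by (rule tendsto_add[OF u(2) v(2)])
    have 2: "\<forall>n. u n + v n \<in> ?D"
      using D_add u(1) v(1) by blast
    show "x + y \<in> closure ?D"
      by (rule closed_sequentially[OF closed_closure _ 1]) (use 2 closure_subset in blast)
  next
    fix c :: real and x assume "x \<in> closure ?D"
    then obtain u where u: "\<forall>n. u n \<in> ?D" "u \<longlonglongrightarrow> x"
      unfolding closure_sequential by blast
    have "c \<in> closure \<rat>" by (simp add: Rats_closure_real)
    then obtain q where q: "\<forall>n. q n \<in> \<rat>" "q \<longlonglongrightarrow> c"
      unfolding closure_sequential by blast
    have 1: "(\<lambda>n. q n *\<^sub>R u n) \<longlonglongrightarrow> c *\<^sub>R x"
      using q(2) u(2) by (rule tendsto_scaleR)
    have 2: "\<forall>n. q n *\<^sub>R u n \<in> ?D"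
      using D_rat q(1) u(1) by blast
    show "c *\<^sub>R x \<in> closure ?D"
      by (rule closed_sequentially[OF closed_closure _ 1]) (use 2 closure_subset in blast)
  qed
  moreover have "L \<subseteq> closure ?D"
  proof
    fix x assume "x \<in> L"
    then have "(1 / (2 * pi)) *\<^sub>R x \<in> ?D"
      unfolding resonant_directions_def by (auto intro!: exI[of _ 1])
    then have "(2 * pi) *\<^sub>R (1 / (2 * pi)) *\<^sub>R x \<in> closure ?D"
      using \<open>subspace (closure ?D)\<close> closure_subset by (blast intro: subspace_scale)
    then show "x \<in> closure ?D" by simp
  qed
  ultimately show ?thesis using span span_minimal by blast
qed

section \<open>Skew maps on four vertices\<close>

locale four_vertex_graph =
  fixes G :: "('v::finite, 'e::finite) pre_digraph" and a b c d :: 'v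
  assumes simple: "simple_digraph G" and arcs: "arcs G = UNIV"
    and distinct: "distinct [a, b, c, d]" and vertices: "UNIV = {a, b, c, d}"
begin

text \<open>
  The bracket of two basis vertices: an edge up to sign, or zero for vertices that are not adjacent.
  Working with these vectors treats all graphs on four vertices at once; the missing edges are zero
  vectors.
\<close>
abbreviation edge :: "'v \<Rightarrow> 'v \<Rightarrow> real ^ 'e" where
  "edge i j \<equiv> edge_bracket G (axis i 1) (axis j 1)"

lemma edge_commute: "edge j i = - edge i j"
  by (rule edge_bracket_commute)

lemma edge_arc: "edge (tail G e) (head G e) = axis e 1"
  using graph_bracket_arc[OF simple arcs, of e] by (simp add: graph_bracket_eq)

lemma edge_cases:
  obtains "edge i j = 0" | e where "i = tail G e" "j = head G e" "edge i j = axis e 1"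
  | e where "j = tail G e" "i = head G e" "edge i j = - axis e 1"
proof -
  consider e where "i = tail G e" "j = head G e" | e where "j = tail G e" "i = head G e"
      | "(i, j) \<notin> arcs_ends G" "(j, i) \<notin> arcs_ends G"
    by (auto simp: arcs_ends_conv arcs)
  then show ?thesis
  proof cases
    case 1 then show ?thesis using that edge_arc by blast
  next
    case (2 e) then show ?thesis using that edge_arc[of e] edge_commute[of i j] by metis
  next
    case 3 then show ?thesis
      using graph_bracket_nonadjacent[OF arcs, of i j] that(1) by (simp add: graph_bracket_eq zero_prod_def)
  qed
qed

lemma edge_orthogonal: "{i, j} \<noteq> {k, l} \<Longrightarrow> edge i j \<bullet> edge k l = 0"
  by (cases i j rule: edge_cases; cases k l rule: edge_cases) (auto simp: inner_axis_axis)

lemma edge_scaleR_norm: "(edge i j \<bullet> edge i j) *\<^sub>R edge i j = edge i j"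
  by (cases i j rule: edge_cases) (auto simp: inner_axis_axis)

lemma norm_edge: "(i, j) \<in> arcs_ends G \<or> (j, i) \<in> arcs_ends G \<Longrightarrow> edge i j \<bullet> edge i j = 1"
proof -
  assume "(i, j) \<in> arcs_ends G \<or> (j, i) \<in> arcs_ends G"
  then obtain e where "i = tail G e \<and> j = head G e \<or> j = tail G e \<and> i = head G e"
    by (auto simp: arcs_ends_conv)
  then have "edge i j = axis e 1 \<or> edge i j = - axis e 1"
    using edge_arc[of e] edge_commute[of i j] by metis
  then show ?thesis by (auto simp: inner_axis_axis)
qed

text \<open>
  Among \<open>e1\<close>, ..., \<open>e6\<close> the opposite pairs, i.e. those without a common vertex, are \<open>e1, e6\<close>,
  \<open>e2, e5\<close> and \<open>e3, e4\<close>.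
\<close>
abbreviation "e1 \<equiv> edge a b"
abbreviation "e2 \<equiv> edge a c"
abbreviation "e3 \<equiv> edge a d"
abbreviation "e4 \<equiv> edge b c"
abbreviation "e5 \<equiv> edge b d"
abbreviation "e6 \<equiv> edge c d"

lemma edge_orthogonal_simps:
  "e1 \<bullet> e2 = 0" "e1 \<bullet> e3 = 0" "e1 \<bullet> e4 = 0" "e1 \<bullet> e5 = 0" "e1 \<bullet> e6 = 0"
  "e2 \<bullet> e1 = 0" "e2 \<bullet> e3 = 0" "e2 \<bullet> e4 = 0" "e2 \<bullet> e5 = 0" "e2 \<bullet> e6 = 0"
  "e3 \<bullet> e1 = 0" "e3 \<bullet> e2 = 0" "e3 \<bullet> e4 = 0" "e3 \<bullet> e5 = 0" "e3 \<bullet> e6 = 0"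
  "e4 \<bullet> e1 = 0" "e4 \<bullet> e2 = 0" "e4 \<bullet> e3 = 0" "e4 \<bullet> e5 = 0" "e4 \<bullet> e6 = 0"
  "e5 \<bullet> e1 = 0" "e5 \<bullet> e2 = 0" "e5 \<bullet> e3 = 0" "e5 \<bullet> e4 = 0" "e5 \<bullet> e6 = 0"
  "e6 \<bullet> e1 = 0" "e6 \<bullet> e2 = 0" "e6 \<bullet> e3 = 0" "e6 \<bullet> e4 = 0" "e6 \<bullet> e5 = 0"
  by (rule edge_orthogonal; use distinct in \<open>auto simp: doubleton_eq_iff\<close>)+

lemma sum_vertices: "(\<Sum>i\<in>UNIV. h i) = h a + h b + h c + (h d :: 'z::comm_monoid_add)"
  unfolding vertices using distinct by (simp add: ac_simps)

lemma vec_expansion: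
  "x = x $ a *\<^sub>R axis a 1 + x $ b *\<^sub>R axis b 1 + x $ c *\<^sub>R axis c 1 + x $ d *\<^sub>R axis d 1"
  for x :: "real ^ 'v"
  using basis_expansion[of x] by (simp add: sum_vertices scalar_mult_eq_scaleR)

lemma vec_eqI: "x $ a = y $ a \<Longrightarrow> x $ b = y $ b \<Longrightarrow> x $ c = y $ c \<Longrightarrow> x $ d = y $ d \<Longrightarrow> x = y"
  for x y :: "'z ^ 'v"
  using vertices by (auto simp: vec_eq_iff)

lemma inner_vertices: "x \<bullet> y = x $ a * y $ a + x $ b * y $ b + x $ c * y $ c + x $ d * y $ d"
  for x y :: "real ^ 'v"
  by (simp add: inner_vec_def sum_vertices)

lemma edge_bracket_expansion:
  "edge_bracket G x y =
     (x $ a * y $ b - x $ b * y $ a) *\<^sub>R e1 + (x $ a * y $ c - x $ c * y $ a) *\<^sub>R e2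
   + (x $ a * y $ d - x $ d * y $ a) *\<^sub>R e3 + (x $ b * y $ c - x $ c * y $ b) *\<^sub>R e4
   + (x $ b * y $ d - x $ d * y $ b) *\<^sub>R e5 + (x $ c * y $ d - x $ d * y $ c) *\<^sub>R e6"
  by (subst (1) vec_expansion[of x], subst (1) vec_expansion[of y])
     (simp add: edge_bracket_simps edge_commute[of b a] edge_commute[of c a] edge_commute[of d a]
       edge_commute[of c b] edge_commute[of d b] edge_commute[of d c] algebra_simps)

lemma edge_expansion:
  "z = (z \<bullet> e1) *\<^sub>R e1 + (z \<bullet> e2) *\<^sub>R e2 + (z \<bullet> e3) *\<^sub>R e3
     + (z \<bullet> e4) *\<^sub>R e4 + (z \<bullet> e5) *\<^sub>R e5 + (z \<bullet> e6) *\<^sub>R e6"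
proof -
  define E where "E z = (z \<bullet> e1) *\<^sub>R e1 + (z \<bullet> e2) *\<^sub>R e2 + (z \<bullet> e3) *\<^sub>R e3
     + (z \<bullet> e4) *\<^sub>R e4 + (z \<bullet> e5) *\<^sub>R e5 + (z \<bullet> e6) *\<^sub>R e6" for z
  have lin: "linear E"
    by (rule linearI) (simp_all add: E_def inner_add_left algebra_simps)
  have six: "E e1 = e1" "E e2 = e2" "E e3 = e3" "E e4 = e4" "E e5 = e5" "E e6 = e6"
    by (simp_all add: E_def edge_orthogonal_simps edge_scaleR_norm)
  have E_edge: "E (edge i j) = edge i j" for i j
  proof -
    have "i \<in> {a, b, c, d}" "j \<in> {a, b, c, d}" using vertices by blast+
    then show ?thesis
      using six linear_neg[OF lin] linear_0[OF lin]
      by (auto simp: edge_commute[of b a] edge_commute[of c a] edge_commute[of d a]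
       edge_commute[of c b] edge_commute[of d b] edge_commute[of d c])
  qed
  have "E (axis e 1) = axis e 1" for e
    using E_edge[of "tail G e" "head G e"] by (simp add: edge_arc)
  then have "E = id"
    by (intro linear_eq_stdbasis[OF lin linear_id]) (auto simp: Basis_vec_def)
  then have "E z = z" by simp
  then show ?thesis by (simp add: E_def)
qed

lemma inner_edges: "z \<bullet> w = (z \<bullet> e1) * (w \<bullet> e1) + (z \<bullet> e2) * (w \<bullet> e2) + (z \<bullet> e3) * (w \<bullet> e3)
     + (z \<bullet> e4) * (w \<bullet> e4) + (z \<bullet> e5) * (w \<bullet> e5) + (z \<bullet> e6) * (w \<bullet> e6)"
  by (subst (1) edge_expansion[of z]) (simp add: inner_add_right inner_commute[of _ w])

lemma skew_map_coordinates:
  "skew_map G z x $ a = - x $ b * (z \<bullet> e1) - x $ c * (z \<bullet> e2) - x $ d * (z \<bullet> e3)"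
  "skew_map G z x $ b = x $ a * (z \<bullet> e1) - x $ c * (z \<bullet> e4) - x $ d * (z \<bullet> e5)"
  "skew_map G z x $ c = x $ a * (z \<bullet> e2) + x $ b * (z \<bullet> e4) - x $ d * (z \<bullet> e6)"
  "skew_map G z x $ d = x $ a * (z \<bullet> e3) + x $ b * (z \<bullet> e5) + x $ c * (z \<bullet> e6)"
  using distinct unfolding skew_map_def
  by (simp_all add: edge_bracket_expansion[of x] inner_add_right inner_commute[of _ z])
     (auto simp: axis_def)

definition pfaffian :: "real ^ 'e \<Rightarrow> real" where
  "pfaffian z = (z \<bullet> e1) * (z \<bullet> e6) - (z \<bullet> e2) * (z \<bullet> e5) + (z \<bullet> e3) * (z \<bullet> e4)"

text \<open>
  The Hodge star of \<open>\<Lambda>^2 \<real>^4\<close> compressed to the span of the edges of the graph: opposite edges are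
  exchanged up to sign, and an edge is sent to zero if the opposite one is missing.
\<close>
definition star :: "real ^ 'e \<Rightarrow> real ^ 'e" where
  "star z = (z \<bullet> e6) *\<^sub>R e1 + (z \<bullet> e1) *\<^sub>R e6 - (z \<bullet> e5) *\<^sub>R e2 - (z \<bullet> e2) *\<^sub>R e5
     + (z \<bullet> e4) *\<^sub>R e3 + (z \<bullet> e3) *\<^sub>R e4"

lemma bounded_linear_star: "bounded_linear star"
  unfolding star_def by (intro bounded_linear_intros)

lemmas star_simps = linear_add[OF bounded_linear.linear[OF bounded_linear_star]]
  linear_diff[OF bounded_linear.linear[OF bounded_linear_star]]
  linear_neg[OF bounded_linear.linear[OF bounded_linear_star]]
  linear_scale[OF bounded_linear.linear[OF bounded_linear_star]]

lemma star_inner: "star z \<bullet> w = z \<bullet> star w"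
  by (simp add: star_def inner_add_left inner_add_right inner_diff_left inner_diff_right
      inner_commute algebra_simps)

lemma inner_star_self: "star z \<bullet> z = 2 * pfaffian z"
  by (simp add: star_def pfaffian_def inner_add_left inner_diff_left inner_commute algebra_simps)

text \<open>
  Applying the operator twice keeps the edges whose opposite is present and kills the others, so it is
  a projection whose range contains the range of the operator itself.
\<close>
lemma star_cubed: "star (star (star z)) = star z"
proof -
  have s: "star e1 = (e1 \<bullet> e1) *\<^sub>R e6" "star e6 = (e6 \<bullet> e6) *\<^sub>R e1"
    "star e2 = - ((e2 \<bullet> e2) *\<^sub>R e5)" "star e5 = - ((e5 \<bullet> e5) *\<^sub>R e2)"
    "star e3 = (e3 \<bullet> e3) *\<^sub>R e4" "star e4 = (e4 \<bullet> e4) *\<^sub>R e3"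
    by (simp_all add: star_def edge_orthogonal_simps)
  have n: "(z \<bullet> edge k l) *\<^sub>R (edge i j \<bullet> edge i j) *\<^sub>R (edge k l \<bullet> edge k l) *\<^sub>R edge i j
      = (z \<bullet> edge k l) *\<^sub>R edge i j" for i j k l
  proof -
    have "(edge k l \<bullet> edge k l) * (z \<bullet> edge k l) = z \<bullet> edge k l"
      using arg_cong[OF edge_scaleR_norm[of k l], of "inner z"] by simp
    then show ?thesis
      by (simp only: scaleR_left_commute[of "edge i j \<bullet> edge i j" "edge k l \<bullet> edge k l"]
          edge_scaleR_norm) (simp add: mult.commute)
  qed
  show ?thesis
    unfolding star_def[of z]
    by (simp only: star_simps s n minus_minus scaleR_minus_right)
qed

text \<open>
  The Cayley-Hamilton identity: \<open>t^4 + |z|^2 t^2 + Pf(z)^2\<close> is the characteristic polynomial of \<open>J(z)\<close>.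
\<close>
lemma skew_map_characteristic:
  "skew_map G z (skew_map G z (skew_map G z (skew_map G z x)))
    + (z \<bullet> z) *\<^sub>R skew_map G z (skew_map G z x) + (pfaffian z)\<^sup>2 *\<^sub>R x = 0"
  by (rule vec_eqI)
     (simp_all add: skew_map_coordinates inner_edges[of z z] pfaffian_def algebra_simps power2_eq_square)

text \<open>
  A two-form \<open>J\<close> on \<open>\<real>^4\<close> splits along a vector \<open>x\<close> into its electric and magnetic parts,
  \<open>|x|^2 J = x \<and> J x + *(x \<and> (*J) x)\<close>. As \<open>(*J) J = -Pf\<close>, an eigenvector of \<open>J^2\<close> satisfies
  \<open>(*J) x = (Pf / \<theta>^2) J x\<close>. The splitting and its image under \<open>*\<close> are then two linear equations for
  \<open>x \<and> J x\<close> and its star, which are solved for \<open>x \<and> J x\<close>; projecting to the edges of the graph turns this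
  into the bracket \<open>[x, J x]\<close>.
\<close>
lemma eigenvector_bracket:
  assumes "skew_map G z (skew_map G z x) = - (\<theta>\<^sup>2) *\<^sub>R x"
  shows "((\<theta>\<^sup>2)\<^sup>2 - (pfaffian z)\<^sup>2) *\<^sub>R edge_bracket G x (skew_map G z x) =
    ((x \<bullet> x) * \<theta>\<^sup>2) *\<^sub>R (\<theta>\<^sup>2 *\<^sub>R z - pfaffian z *\<^sub>R star z)"
proof -
  let ?y = "skew_map G z x" and ?p = "pfaffian z"
  \<comment> \<open>the coordinates of \<open>(*J) x\<close>\<close>
  define wa where "wa = - x$b * (z \<bullet> e6) + x$c * (z \<bullet> e5) - x$d * (z \<bullet> e4)"
  define wb where "wb = x$a * (z \<bullet> e6) - x$c * (z \<bullet> e3) + x$d * (z \<bullet> e2)"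
  define wc where "wc = - x$a * (z \<bullet> e5) + x$b * (z \<bullet> e3) - x$d * (z \<bullet> e1)"
  define wd where "wd = x$a * (z \<bullet> e4) - x$b * (z \<bullet> e2) + x$c * (z \<bullet> e1)"
  have x: "\<theta>\<^sup>2 * x$a = - (skew_map G z ?y $ a)" "\<theta>\<^sup>2 * x$b = - (skew_map G z ?y $ b)"
     "\<theta>\<^sup>2 * x$c = - (skew_map G z ?y $ c)" "\<theta>\<^sup>2 * x$d = - (skew_map G z ?y $ d)"
    using assms by simp_all
  have "\<theta>\<^sup>2 * wa = - (\<theta>\<^sup>2 * x$b) * (z \<bullet> e6) + (\<theta>\<^sup>2 * x$c) * (z \<bullet> e5) - (\<theta>\<^sup>2 * x$d) * (z \<bullet> e4)"
    "\<theta>\<^sup>2 * wb = (\<theta>\<^sup>2 * x$a) * (z \<bullet> e6) - (\<theta>\<^sup>2 * x$c) * (z \<bullet> e3) + (\<theta>\<^sup>2 * x$d) * (z \<bullet> e2)"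
    "\<theta>\<^sup>2 * wc = - (\<theta>\<^sup>2 * x$a) * (z \<bullet> e5) + (\<theta>\<^sup>2 * x$b) * (z \<bullet> e3) - (\<theta>\<^sup>2 * x$d) * (z \<bullet> e1)"
    "\<theta>\<^sup>2 * wd = (\<theta>\<^sup>2 * x$a) * (z \<bullet> e4) - (\<theta>\<^sup>2 * x$b) * (z \<bullet> e2) + (\<theta>\<^sup>2 * x$c) * (z \<bullet> e1)"
    by (simp_all add: wa_def wb_def wc_def wd_def algebra_simps)
  then have w: "\<theta>\<^sup>2 * wa = ?p * ?y$a" "\<theta>\<^sup>2 * wb = ?p * ?y$b"
    "\<theta>\<^sup>2 * wc = ?p * ?y$c" "\<theta>\<^sup>2 * wd = ?p * ?y$d"
    unfolding x skew_map_coordinates(1-4)[of z ?y] pfaffian_def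
    by (simp_all add: algebra_simps)
  \<comment> \<open>electric and magnetic parts, one equation for each pair of vertices\<close>
  have split: "(x \<bullet> x) * (z \<bullet> e1) = (x$a * ?y$b - x$b * ?y$a) + 1 * (x$c * wd - x$d * wc)"
    "(x \<bullet> x) * (z \<bullet> e6) = (x$c * ?y$d - x$d * ?y$c) + 1 * (x$a * wb - x$b * wa)"
    "(x \<bullet> x) * (z \<bullet> e2) = (x$a * ?y$c - x$c * ?y$a) + (-1) * (x$b * wd - x$d * wb)"
    "(x \<bullet> x) * (z \<bullet> e5) = (x$b * ?y$d - x$d * ?y$b) + (-1) * (x$a * wc - x$c * wa)"
    "(x \<bullet> x) * (z \<bullet> e3) = (x$a * ?y$d - x$d * ?y$a) + 1 * (x$b * wc - x$c * wb)"
    "(x \<bullet> x) * (z \<bullet> e4) = (x$b * ?y$c - x$c * ?y$b) + 1 * (x$a * wd - x$d * wa)"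
    by (simp_all add: skew_map_coordinates inner_vertices wa_def wb_def wc_def wd_def algebra_simps)
  \<comment> \<open>eliminates the opposite component \<open>B'\<close>; \<open>s\<close> is the sign of the star on the pair of opposite edges\<close>
  have solve: "((\<theta>\<^sup>2)\<^sup>2 - ?p\<^sup>2) * B = ((x \<bullet> x) * \<theta>\<^sup>2) * (\<theta>\<^sup>2 * m - ?p * (s * m'))"
    if "(x \<bullet> x) * m = B + s * W'" "(x \<bullet> x) * m' = B' + s * W"
      "\<theta>\<^sup>2 * W = ?p * B" "\<theta>\<^sup>2 * W' = ?p * B'" "s * s = 1" for B B' W W' m m' s
  proof -
    have "((x \<bullet> x) * \<theta>\<^sup>2) * (\<theta>\<^sup>2 * m - ?p * (s * m'))
       = \<theta>\<^sup>2 * (\<theta>\<^sup>2 * ((x \<bullet> x) * m)) - ?p * s * (\<theta>\<^sup>2 * ((x \<bullet> x) * m'))"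
      by (simp add: algebra_simps)
    also have "\<dots> = \<theta>\<^sup>2 * (\<theta>\<^sup>2 * B + s * (\<theta>\<^sup>2 * W')) - ?p * s * \<theta>\<^sup>2 * B' - ?p * (s * s) * (\<theta>\<^sup>2 * W)"
      unfolding that(1,2) by (simp add: algebra_simps)
    also have "\<dots> = ((\<theta>\<^sup>2)\<^sup>2 - ?p\<^sup>2) * B"
      unfolding that(3-5) by (simp add: algebra_simps power2_eq_square)
    finally show ?thesis by simp
  qed
  have W: "\<theta>\<^sup>2 * (x$i * w2 - x$j * w1) = ?p * (x$i * ?y$j - x$j * ?y$i)"
    if "\<theta>\<^sup>2 * w1 = ?p * ?y$i" "\<theta>\<^sup>2 * w2 = ?p * ?y$j" for i j w1 w2
  proof -
    have "\<theta>\<^sup>2 * (x$i * w2 - x$j * w1) = x$i * (\<theta>\<^sup>2 * w2) - x$j * (\<theta>\<^sup>2 * w1)" by (simp add: algebra_simps)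
    then show ?thesis unfolding that by (simp add: algebra_simps)
  qed
  have B:
    "((\<theta>\<^sup>2)\<^sup>2 - ?p\<^sup>2) * (x$a * ?y$b - x$b * ?y$a) = ((x \<bullet> x) * \<theta>\<^sup>2) * (\<theta>\<^sup>2 * (z \<bullet> e1) - ?p * (1 * (z \<bullet> e6)))"
    "((\<theta>\<^sup>2)\<^sup>2 - ?p\<^sup>2) * (x$c * ?y$d - x$d * ?y$c) = ((x \<bullet> x) * \<theta>\<^sup>2) * (\<theta>\<^sup>2 * (z \<bullet> e6) - ?p * (1 * (z \<bullet> e1)))"
    "((\<theta>\<^sup>2)\<^sup>2 - ?p\<^sup>2) * (x$a * ?y$c - x$c * ?y$a) = ((x \<bullet> x) * \<theta>\<^sup>2) * (\<theta>\<^sup>2 * (z \<bullet> e2) - ?p * ((-1) * (z \<bullet> e5)))"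
    "((\<theta>\<^sup>2)\<^sup>2 - ?p\<^sup>2) * (x$b * ?y$d - x$d * ?y$b) = ((x \<bullet> x) * \<theta>\<^sup>2) * (\<theta>\<^sup>2 * (z \<bullet> e5) - ?p * ((-1) * (z \<bullet> e2)))"
    "((\<theta>\<^sup>2)\<^sup>2 - ?p\<^sup>2) * (x$a * ?y$d - x$d * ?y$a) = ((x \<bullet> x) * \<theta>\<^sup>2) * (\<theta>\<^sup>2 * (z \<bullet> e3) - ?p * (1 * (z \<bullet> e4)))"
    "((\<theta>\<^sup>2)\<^sup>2 - ?p\<^sup>2) * (x$b * ?y$c - x$c * ?y$b) = ((x \<bullet> x) * \<theta>\<^sup>2) * (\<theta>\<^sup>2 * (z \<bullet> e4) - ?p * (1 * (z \<bullet> e3)))"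
    apply (rule solve[OF split(1) split(2) W[OF w(1,2)] W[OF w(3,4)]], simp)
    apply (rule solve[OF split(2) split(1) W[OF w(3,4)] W[OF w(1,2)]], simp)
    apply (rule solve[OF split(3) split(4) W[OF w(1,3)] W[OF w(2,4)]], simp)
    apply (rule solve[OF split(4) split(3) W[OF w(2,4)] W[OF w(1,3)]], simp)
    apply (rule solve[OF split(5) split(6) W[OF w(1,4)] W[OF w(2,3)]], simp)
    apply (rule solve[OF split(6) split(5) W[OF w(2,3)] W[OF w(1,4)]], simp)
    done
  have z: "\<theta>\<^sup>2 *\<^sub>R z = \<theta>\<^sup>2 *\<^sub>R ((z \<bullet> e1) *\<^sub>R e1 + (z \<bullet> e2) *\<^sub>R e2 + (z \<bullet> e3) *\<^sub>R e3
     + (z \<bullet> e4) *\<^sub>R e4 + (z \<bullet> e5) *\<^sub>R e5 + (z \<bullet> e6) *\<^sub>R e6)"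
    by (rule arg_cong[OF edge_expansion[of z], of "\<lambda>w. \<theta>\<^sup>2 *\<^sub>R w"])
  have zs: "\<theta>\<^sup>2 *\<^sub>R z - ?p *\<^sub>R star z = (\<theta>\<^sup>2 * (z \<bullet> e1) - ?p * (1 * (z \<bullet> e6))) *\<^sub>R e1
     + (\<theta>\<^sup>2 * (z \<bullet> e2) - ?p * ((-1) * (z \<bullet> e5))) *\<^sub>R e2 + (\<theta>\<^sup>2 * (z \<bullet> e3) - ?p * (1 * (z \<bullet> e4))) *\<^sub>R e3
     + (\<theta>\<^sup>2 * (z \<bullet> e4) - ?p * (1 * (z \<bullet> e3))) *\<^sub>R e4 + (\<theta>\<^sup>2 * (z \<bullet> e5) - ?p * ((-1) * (z \<bullet> e2))) *\<^sub>R e5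
     + (\<theta>\<^sup>2 * (z \<bullet> e6) - ?p * (1 * (z \<bullet> e1))) *\<^sub>R e6"
    unfolding z star_def
    by (simp only: scaleR_add_right scaleR_diff_right scaleR_scaleR scaleR_left_diff_distrib
        mult_minus_right mult_minus_left mult_1_left scaleR_minus_left) (simp add: algebra_simps)
  show ?thesis
    unfolding zs edge_bracket_expansion[of x ?y]
    by (simp only: scaleR_add_right scaleR_scaleR B)
qed

end

section \<open>Frequencies and drift\<close>

context four_vertex_graph
begin

text \<open>
  The components of \<open>z\<close> in the eigenspaces of \<open>star\<close> for \<open>1\<close>, \<open>-1\<close> and \<open>0\<close>. They exist because
  \<open>t^3 - t\<close> annihilates the operator.
\<close>
definition star_pos :: "real ^ 'e \<Rightarrow> real ^ 'e" where
  "star_pos z = (1/2) *\<^sub>R (star (star z) + star z)"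

definition star_neg :: "real ^ 'e \<Rightarrow> real ^ 'e" where
  "star_neg z = (1/2) *\<^sub>R (star (star z) - star z)"

definition star_null :: "real ^ 'e \<Rightarrow> real ^ 'e" where
  "star_null z = z - star (star z)"

lemma star_decomposition: "z = star_pos z + star_neg z + star_null z"
  by (simp add: star_pos_def star_neg_def star_null_def algebra_simps flip: scaleR_add_left)

lemma star_eq_pos_neg: "star z = star_pos z - star_neg z"
  by (simp add: star_pos_def star_neg_def algebra_simps flip: scaleR_add_left)

lemma star_eigen: "star (star_pos z) = star_pos z" "star (star_neg z) = - star_neg z"
  "star (star_null z) = 0"
  by (simp_all add: star_pos_def star_neg_def star_null_def star_simps star_cubed algebra_simps)

lemma star_parts_unique:
  assumes "star p = p" "star m = - m" "star n = 0"
  shows "star_pos (p + m + n) = p" "star_neg (p + m + n) = m" "star_null (p + m + n) = n"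
proof -
  have 1: "star (p + m + n) = p - m" and 2: "star (p - m) = p + m"
    using assms by (simp_all add: star_simps)
  have 3: "p + m + (p - m) = 2 *\<^sub>R p" "p + m - (p - m) = 2 *\<^sub>R m"
    by (simp_all add: scaleR_2)
  show "star_pos (p + m + n) = p" "star_neg (p + m + n) = m" "star_null (p + m + n) = n"
    unfolding star_pos_def star_neg_def star_null_def 1 2 3 by simp_all
qed

lemma star_parts_orthogonal:
  "star_pos z \<bullet> star_neg z = 0" "star_pos z \<bullet> star_null z = 0" "star_neg z \<bullet> star_null z = 0"
  using star_inner[of "star_pos z" "star_neg z"] star_inner[of "star_pos z" "star_null z"]
    star_inner[of "star_neg z" "star_null z"]
  by (simp_all add: star_eigen)

lemma bounded_linear_star_parts:
  "bounded_linear star_pos" "bounded_linear star_neg" "bounded_linear star_null"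
  unfolding star_pos_def star_neg_def star_null_def
  by (intro bounded_linear_intros bounded_linear_compose[OF bounded_linear_star] bounded_linear_star)+

definition freq_sum :: "real ^ 'e \<Rightarrow> real" where
  "freq_sum z = sqrt (z \<bullet> z + 2 * pfaffian z)"

definition freq_diff :: "real ^ 'e \<Rightarrow> real" where
  "freq_diff z = sqrt (z \<bullet> z - 2 * pfaffian z)"

text \<open>
  The frequencies of \<open>J(z)\<close>, signed so that their product is the Pfaffian and not only its absolute
  value: \<open>freq2 z\<close> has the sign of \<open>pfaffian z\<close>.
\<close>
definition freq1 :: "real ^ 'e \<Rightarrow> real" where "freq1 z = (freq_sum z + freq_diff z) / 2"
definition freq2 :: "real ^ 'e \<Rightarrow> real" where "freq2 z = (freq_sum z - freq_diff z) / 2"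

text \<open>
  The right-hand sides show that the radicands of \<open>freq_sum\<close> and \<open>freq_diff\<close> are nonnegative, and
  positive when the positive or the negative component of \<open>z\<close> is nonzero, respectively.
\<close>
lemma freq_radicands:
  "z \<bullet> z + 2 * pfaffian z = 2 * (star_pos z \<bullet> star_pos z) + star_null z \<bullet> star_null z"
  "z \<bullet> z - 2 * pfaffian z = 2 * (star_neg z \<bullet> star_neg z) + star_null z \<bullet> star_null z"
proof -
  let ?p = "star_pos z" and ?m = "star_neg z" and ?n = "star_null z"
  have "z \<bullet> z = (?p + ?m + ?n) \<bullet> (?p + ?m + ?n)"
    using star_decomposition[of z] by simp
  then have 1: "z \<bullet> z = ?p \<bullet> ?p + ?m \<bullet> ?m + ?n \<bullet> ?n"
    by (simp add: inner_add_left inner_add_right star_parts_orthogonal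
        star_parts_orthogonal[THEN trans[OF inner_commute]])
  have "star z \<bullet> z = (?p - ?m) \<bullet> (?p + ?m + ?n)"
    using star_decomposition[of z] star_eq_pos_neg[of z] by simp
  then have 2: "2 * pfaffian z = ?p \<bullet> ?p - ?m \<bullet> ?m"
    by (simp add: inner_star_self inner_add_right inner_diff_left star_parts_orthogonal
        star_parts_orthogonal[THEN trans[OF inner_commute]])
  show "z \<bullet> z + 2 * pfaffian z = 2 * (?p \<bullet> ?p) + ?n \<bullet> ?n" "z \<bullet> z - 2 * pfaffian z = 2 * (?m \<bullet> ?m) + ?n \<bullet> ?n"
    unfolding 1 2 by simp_all
qed

lemma freq_squares:
  "(freq_sum z)\<^sup>2 = z \<bullet> z + 2 * pfaffian z" "(freq_diff z)\<^sup>2 = z \<bullet> z - 2 * pfaffian z"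
  unfolding freq_sum_def freq_diff_def by (simp_all add: freq_radicands)

lemma freq_relations:
  "freq1 z + freq2 z = freq_sum z" "freq1 z - freq2 z = freq_diff z"
  "(freq1 z)\<^sup>2 + (freq2 z)\<^sup>2 = z \<bullet> z" "freq1 z * freq2 z = pfaffian z"
  "(freq1 z)\<^sup>2 - (freq2 z)\<^sup>2 = freq_sum z * freq_diff z"
proof -
  show "freq1 z + freq2 z = freq_sum z" "freq1 z - freq2 z = freq_diff z"
    by (simp_all add: freq1_def freq2_def field_simps)
  have "(freq1 z)\<^sup>2 + (freq2 z)\<^sup>2 = ((freq_sum z)\<^sup>2 + (freq_diff z)\<^sup>2) / 2"
    by (simp add: freq1_def freq2_def power2_eq_square field_simps)
  then show "(freq1 z)\<^sup>2 + (freq2 z)\<^sup>2 = z \<bullet> z" by (simp add: freq_squares)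
  have "freq1 z * freq2 z = ((freq_sum z)\<^sup>2 - (freq_diff z)\<^sup>2) / 4"
    by (simp add: freq1_def freq2_def power2_eq_square field_simps)
  then show "freq1 z * freq2 z = pfaffian z" by (simp add: freq_squares)
  show "(freq1 z)\<^sup>2 - (freq2 z)\<^sup>2 = freq_sum z * freq_diff z"
    by (simp add: freq1_def freq2_def power2_eq_square field_simps)
qed

text \<open>
  The projections to the two eigenspaces of \<open>J(z)^2\<close>, as polynomials in \<open>J(z)^2\<close>. This form shows
  that they depend continuously on \<open>z\<close>.
\<close>
definition part1 :: "real ^ 'e \<Rightarrow> real ^ 'v \<Rightarrow> real ^ 'v" where
  "part1 z x = - (1 / (freq_sum z * freq_diff z)) *\<^sub>R (skew_map G z (skew_map G z x) + (freq2 z)\<^sup>2 *\<^sub>R x)"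

definition part2 :: "real ^ 'e \<Rightarrow> real ^ 'v \<Rightarrow> real ^ 'v" where
  "part2 z x = (1 / (freq_sum z * freq_diff z)) *\<^sub>R (skew_map G z (skew_map G z x) + (freq1 z)\<^sup>2 *\<^sub>R x)"

lemma part1_plus_part2:
  assumes "freq_sum z \<noteq> 0" "freq_diff z \<noteq> 0"
  shows "part1 z x + part2 z x = x"
proof -
  have "part1 z x + part2 z x =
      (1 / (freq_sum z * freq_diff z)) *\<^sub>R (((freq1 z)\<^sup>2 - (freq2 z)\<^sup>2) *\<^sub>R x)"
    by (simp add: part1_def part2_def scaleR_add_right scaleR_left_diff_distrib scaleR_diff_right)
  then show ?thesis using assms by (simp add: freq_relations)
qed

lemma skew_map_part:
  "skew_map G z (skew_map G z (part1 z x)) = - ((freq1 z)\<^sup>2) *\<^sub>R part1 z x"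
  "skew_map G z (skew_map G z (part2 z x)) = - ((freq2 z)\<^sup>2) *\<^sub>R part2 z x"
proof -
  let ?J = "skew_map G z"
  have "?J (?J (?J (?J x))) = - ((z \<bullet> z) *\<^sub>R ?J (?J x)) - (pfaffian z)\<^sup>2 *\<^sub>R x"
    using skew_map_characteristic[of z x] by (simp add: algebra_simps eq_neg_iff_add_eq_0)
  then have J4: "?J (?J (?J (?J x))) = - (((freq1 z)\<^sup>2 + (freq2 z)\<^sup>2) *\<^sub>R ?J (?J x))
      - ((freq1 z)\<^sup>2 * (freq2 z)\<^sup>2) *\<^sub>R x"
    by (simp only: freq_relations(3) freq_relations(4)[symmetric] power_mult_distrib)
  show "?J (?J (part1 z x)) = - ((freq1 z)\<^sup>2) *\<^sub>R part1 z x"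
    "?J (?J (part2 z x)) = - ((freq2 z)\<^sup>2) *\<^sub>R part2 z x"
    unfolding part1_def part2_def
    by (simp_all add: skew_map_simps J4 algebra_simps)
qed

text \<open>
  The drift is a combination of \<open>z\<close> and \<open>star z\<close> by \<open>eigenvector_bracket\<close>, so it stretches the three
  components of \<open>z\<close> separately. The stretching factors are affine functions of the numbers
  \<open>qi = |Xi|^2 / (2 \<theta>i)\<close>, and the factor on the null component is the mean of the other two.
\<close>
lemma closing_translation_eigenvectors:
  assumes nz: "freq_sum z \<noteq> 0" "freq_diff z \<noteq> 0" "pfaffian z \<noteq> 0"
    and X1: "skew_map G z (skew_map G z X1) = - ((freq1 z)\<^sup>2) *\<^sub>R X1"
    and X2: "skew_map G z (skew_map G z X2) = - ((freq2 z)\<^sup>2) *\<^sub>R X2"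
    and q1: "X1 \<bullet> X1 = 2 * freq1 z * q1" and q2: "X2 \<bullet> X2 = 2 * freq2 z * q2"
    and u: "(u - 1) * freq_sum z = q1 + q2" and v: "(v - 1) * freq_diff z = q1 - q2"
  shows "closing_translation G z (freq1 z) (freq2 z) X1 X2 =
    u *\<^sub>R star_pos z + v *\<^sub>R star_neg z + ((u + v) / 2) *\<^sub>R star_null z"
proof -
  let ?f = "freq_sum z" and ?g = "freq_diff z" and ?a = "freq1 z" and ?b = "freq2 z"
  have ab: "?a \<noteq> 0" "?b \<noteq> 0" using freq_relations(4)[of z] nz by auto
  have c1: "(?a\<^sup>2)\<^sup>2 - (pfaffian z)\<^sup>2 = ?a\<^sup>2 * (?f * ?g)"
    and c2: "(?b\<^sup>2)\<^sup>2 - (pfaffian z)\<^sup>2 = - (?b\<^sup>2 * (?f * ?g))"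
    unfolding freq_relations(5)[symmetric] freq_relations(4)[symmetric]
    by (simp_all add: power2_eq_square algebra_simps)
  have B1: "(1 / ?a\<^sup>2) *\<^sub>R edge_bracket G X1 (skew_map G z X1) =
      (2 * q1 / (?f * ?g)) *\<^sub>R (?a *\<^sub>R z - ?b *\<^sub>R star z)"
  proof -
    have "(1 / (?a\<^sup>2 * ?a\<^sup>2 * (?f * ?g))) *\<^sub>R ((?a\<^sup>2 * (?f * ?g)) *\<^sub>R edge_bracket G X1 (skew_map G z X1))
      = (1 / (?a\<^sup>2 * ?a\<^sup>2 * (?f * ?g))) *\<^sub>R (((2 * ?a * q1) * ?a\<^sup>2) *\<^sub>R (?a\<^sup>2 *\<^sub>R z - (?a * ?b) *\<^sub>R star z))"
      using eigenvector_bracket[OF X1] unfolding c1 q1 freq_relations(4) by simp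
    also have "?a\<^sup>2 *\<^sub>R z - (?a * ?b) *\<^sub>R star z = ?a *\<^sub>R (?a *\<^sub>R z - ?b *\<^sub>R star z)"
      by (simp add: power2_eq_square scaleR_diff_right)
    finally show ?thesis
      using ab nz by (simp add: power2_eq_square)
  qed
  have B2: "(1 / ?b\<^sup>2) *\<^sub>R edge_bracket G X2 (skew_map G z X2) =
      - (2 * q2 / (?f * ?g)) *\<^sub>R (?b *\<^sub>R z - ?a *\<^sub>R star z)"
  proof -
    have "- (1 / (?b\<^sup>2 * ?b\<^sup>2 * (?f * ?g))) *\<^sub>R (- (?b\<^sup>2 * (?f * ?g)) *\<^sub>R edge_bracket G X2 (skew_map G z X2))
      = - (1 / (?b\<^sup>2 * ?b\<^sup>2 * (?f * ?g))) *\<^sub>R (((2 * ?b * q2) * ?b\<^sup>2) *\<^sub>R (?b\<^sup>2 *\<^sub>R z - (?a * ?b) *\<^sub>R star z))"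
      using eigenvector_bracket[OF X2] unfolding c2 q2 freq_relations(4) by simp
    also have "?b\<^sup>2 *\<^sub>R z - (?a * ?b) *\<^sub>R star z = ?b *\<^sub>R (?b *\<^sub>R z - ?a *\<^sub>R star z)"
      by (simp add: power2_eq_square scaleR_diff_right)
    finally show ?thesis
      using ab nz by (simp add: power2_eq_square)
  qed
  define \<alpha> where "\<alpha> = (q1 * ?a - q2 * ?b) / (?f * ?g)"
  define \<beta> where "\<beta> = (q2 * ?a - q1 * ?b) / (?f * ?g)"
  have "closing_translation G z ?a ?b X1 X2 = (1 + \<alpha>) *\<^sub>R z + \<beta> *\<^sub>R star z"
  proof -
    have "closing_translation G z ?a ?b X1 X2 =
      z + (q1 / (?f * ?g)) *\<^sub>R (?a *\<^sub>R z - ?b *\<^sub>R star z) - (q2 / (?f * ?g)) *\<^sub>R (?b *\<^sub>R z - ?a *\<^sub>R star z)"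
    proof -
      have h: "(1/2) * (2 * q1 / (?f * ?g)) = q1 / (?f * ?g)"
        "(1/2) * - (2 * q2 / (?f * ?g)) = - (q2 / (?f * ?g))" by simp_all
      show ?thesis
        unfolding closing_translation_def B1 B2
        by (simp only: scaleR_add_right scaleR_scaleR h) simp
    qed
    then show ?thesis
      by (simp add: \<alpha>_def \<beta>_def diff_divide_distrib scaleR_diff_right scaleR_left_distrib
          scaleR_left_diff_distrib)
  qed
  also have "\<dots> = (1 + \<alpha> + \<beta>) *\<^sub>R star_pos z + (1 + \<alpha> - \<beta>) *\<^sub>R star_neg z + (1 + \<alpha>) *\<^sub>R star_null z"
    by (subst (1) star_decomposition) (simp add: star_eq_pos_neg algebra_simps)
  also have "1 + \<alpha> + \<beta> = u"
  proof -
    have "\<alpha> + \<beta> = (q1 + q2) * (?a - ?b) / (?f * ?g)"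
      by (simp add: \<alpha>_def \<beta>_def add_divide_distrib[symmetric] algebra_simps)
    then have "\<alpha> + \<beta> = (q1 + q2) / ?f" using nz by (simp add: freq_relations)
    then show ?thesis using nz u[symmetric] by simp
  qed
  also have "1 + \<alpha> - \<beta> = v"
  proof -
    have "\<alpha> - \<beta> = (q1 - q2) * (?a + ?b) / (?f * ?g)"
      by (simp add: \<alpha>_def \<beta>_def diff_divide_distrib[symmetric] algebra_simps)
    then have "\<alpha> - \<beta> = (q1 - q2) / ?g" using nz by (simp add: freq_relations)
    then show ?thesis using nz v[symmetric] by simp
  qed
  also have "1 + \<alpha> = (u + v) / 2"
    using \<open>1 + \<alpha> + \<beta> = u\<close> \<open>1 + \<alpha> - \<beta> = v\<close> by simp
  finally show ?thesis .
qed

text \<open>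
  The central vector whose drift is \<open>y\<close> when the stretching factors are \<open>u\<close> and \<open>v\<close>.
\<close>
definition stretch_inv :: "real ^ 'e \<Rightarrow> real \<Rightarrow> real \<Rightarrow> real ^ 'e" where
  "stretch_inv y u v = (1 / u) *\<^sub>R star_pos y + (1 / v) *\<^sub>R star_neg y + (2 / (u + v)) *\<^sub>R star_null y"

lemma stretch_inv_parts:
  "star_pos (stretch_inv y u v) = (1 / u) *\<^sub>R star_pos y"
  "star_neg (stretch_inv y u v) = (1 / v) *\<^sub>R star_neg y"
  "star_null (stretch_inv y u v) = (2 / (u + v)) *\<^sub>R star_null y"
  unfolding stretch_inv_def
  by (rule star_parts_unique; simp add: star_simps star_eigen)+

lemma stretch_inv_stretch:
  assumes "u \<noteq> 0" "v \<noteq> 0" "u + v \<noteq> 0"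
  shows "stretch_inv (u *\<^sub>R star_pos z + v *\<^sub>R star_neg z + ((u + v) / 2) *\<^sub>R star_null z) u v = z"
    and "u *\<^sub>R star_pos (stretch_inv z u v) + v *\<^sub>R star_neg (stretch_inv z u v)
      + ((u + v) / 2) *\<^sub>R star_null (stretch_inv z u v) = z"
proof -
  have "star_pos (u *\<^sub>R star_pos z + v *\<^sub>R star_neg z + ((u + v) / 2) *\<^sub>R star_null z) = u *\<^sub>R star_pos z"
    "star_neg (u *\<^sub>R star_pos z + v *\<^sub>R star_neg z + ((u + v) / 2) *\<^sub>R star_null z) = v *\<^sub>R star_neg z"
    "star_null (u *\<^sub>R star_pos z + v *\<^sub>R star_neg z + ((u + v) / 2) *\<^sub>R star_null z) = ((u + v) / 2) *\<^sub>R star_null z"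
    by (rule star_parts_unique; simp add: star_simps star_eigen)+
  note parts = this
  have h: "1 / u * u = 1" "1 / v * v = 1" "2 / (u + v) * ((u + v) / 2) = 1"
    using assms by simp_all
  show "stretch_inv (u *\<^sub>R star_pos z + v *\<^sub>R star_neg z + ((u + v) / 2) *\<^sub>R star_null z) u v = z"
    unfolding stretch_inv_def[of _ u v] parts
    by (simp only: scaleR_scaleR h scaleR_one star_decomposition[symmetric])
  have h: "u * (1 / u) = 1" "v * (1 / v) = 1" "(u + v) / 2 * (2 / (u + v)) = 1"
    using assms by simp_all
  show "u *\<^sub>R star_pos (stretch_inv z u v) + v *\<^sub>R star_neg (stretch_inv z u v)
      + ((u + v) / 2) *\<^sub>R star_null (stretch_inv z u v) = z"
    unfolding stretch_inv_parts
    by (simp only: scaleR_scaleR h scaleR_one star_decomposition[symmetric])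
qed


text \<open>
  The passage from \<open>(X, Z)\<close> to the triple \<open>(Y, u, v)\<close> has a continuous right inverse near a generic
  point: \<open>Z\<close> is \<open>stretch_inv Y u v\<close>, and the components of \<open>x0\<close> in the eigenspaces of \<open>J(Z)^2\<close> are
  rescaled to the lengths that \<open>u\<close> and \<open>v\<close> prescribe. The drift of the resulting vector is exactly \<open>Y\<close>.
\<close>
lemma closing_vector_perturbation:
  fixes x0 :: "real ^ 'v"
  assumes nz: "freq_sum z0 \<noteq> 0" "freq_diff z0 \<noteq> 0" "pfaffian z0 \<noteq> 0"
    and parts: "part1 z0 x0 \<noteq> 0" "part2 z0 x0 \<noteq> 0"
    and q1: "part1 z0 x0 \<bullet> part1 z0 x0 = 2 * freq1 z0 * q1"
    and q2: "part2 z0 x0 \<bullet> part2 z0 x0 = 2 * freq2 z0 * q2"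
    and u0: "(u0 - 1) * freq_sum z0 = q1 + q2" and v0: "(v0 - 1) * freq_diff z0 = q1 - q2"
    and uv: "u0 \<noteq> 0" "v0 \<noteq> 0" "u0 + v0 \<noteq> 0"
    and "e > 0"
  defines "y0 \<equiv> u0 *\<^sub>R star_pos z0 + v0 *\<^sub>R star_neg z0 + ((u0 + v0) / 2) *\<^sub>R star_null z0"
  shows "\<forall>\<^sub>F (y, u, v) in nhds (y0, u0, v0). \<exists>X1 X2 z. z = stretch_inv y u v
    \<and> dist (X1 + X2) x0 < e \<and> dist z z0 < e
    \<and> skew_map G z (skew_map G z X1) = - ((freq1 z)\<^sup>2) *\<^sub>R X1
    \<and> skew_map G z (skew_map G z X2) = - ((freq2 z)\<^sup>2) *\<^sub>R X2
    \<and> freq1 z \<noteq> 0 \<and> freq2 z \<noteq> 0 \<and> (freq1 z)\<^sup>2 \<noteq> (freq2 z)\<^sup>2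
    \<and> closing_translation G z (freq1 z) (freq2 z) X1 X2 = y"
proof -
  define F where "F = nhds (y0, u0, v0)"
  define U where "U p = fst (snd p)" for p :: "(real ^ 'e) \<times> real \<times> real"
  define V where "V p = snd (snd p)" for p :: "(real ^ 'e) \<times> real \<times> real"
  define Z where "Z p = stretch_inv (fst p) (U p) (V p)" for p
  \<comment> \<open>the values of \<open>|Xi|^2 / (2 \<theta>i)\<close> that \<open>u\<close> and \<open>v\<close> require\<close>
  define Q1 where "Q1 p = ((U p - 1) * freq_sum (Z p) + (V p - 1) * freq_diff (Z p)) / 2" for p
  define Q2 where "Q2 p = ((U p - 1) * freq_sum (Z p) - (V p - 1) * freq_diff (Z p)) / 2" for p
  define X1 where "X1 p = (sqrt (2 * freq1 (Z p) * Q1 p) / norm (part1 (Z p) x0)) *\<^sub>R part1 (Z p) x0" for p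
  define X2 where "X2 p = (sqrt (2 * freq2 (Z p) * Q2 p) / norm (part2 (Z p) x0)) *\<^sub>R part2 (Z p) x0" for p
  have id: "((\<lambda>p. p) \<longlongrightarrow> (y0, u0, v0)) F" unfolding F_def by (rule filterlim_ident)
  have Yt: "(fst \<longlongrightarrow> y0) F" using tendsto_fst[OF id] by simp
  have Ut: "(U \<longlongrightarrow> u0) F" unfolding U_def using tendsto_fst[OF tendsto_snd[OF id]] by simp
  have Vt: "(V \<longlongrightarrow> v0) F" unfolding V_def using tendsto_snd[OF tendsto_snd[OF id]] by simp
  note lin = bounded_linear_star_parts[THEN bounded_linear.tendsto]
  have "(Z \<longlongrightarrow> stretch_inv y0 u0 v0) F"
    unfolding Z_def stretch_inv_def by (intro tendsto_intros lin Yt Ut Vt uv)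
  then have Zt: "(Z \<longlongrightarrow> z0) F"
    unfolding y0_def stretch_inv_stretch(1)[OF uv] .
  have pft: "((\<lambda>p. pfaffian (Z p)) \<longlongrightarrow> pfaffian z0) F"
    unfolding pfaffian_def by (intro tendsto_intros Zt)
  have ft: "((\<lambda>p. freq_sum (Z p)) \<longlongrightarrow> freq_sum z0) F" and gt: "((\<lambda>p. freq_diff (Z p)) \<longlongrightarrow> freq_diff z0) F"
    unfolding freq_sum_def freq_diff_def by (intro tendsto_intros Zt pft)+
  have 1: "((\<lambda>p. freq1 (Z p)) \<longlongrightarrow> freq1 z0) F" and 2: "((\<lambda>p. freq2 (Z p)) \<longlongrightarrow> freq2 z0) F"
    unfolding freq1_def freq2_def by (intro tendsto_intros ft gt; simp)+
  have "(Q1 \<longlongrightarrow> ((u0 - 1) * freq_sum z0 + (v0 - 1) * freq_diff z0) / 2) F"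
    "(Q2 \<longlongrightarrow> ((u0 - 1) * freq_sum z0 - (v0 - 1) * freq_diff z0) / 2) F"
    unfolding Q1_def Q2_def by (intro tendsto_intros Ut Vt ft gt; simp)+
  then have Q1t: "(Q1 \<longlongrightarrow> q1) F" and Q2t: "(Q2 \<longlongrightarrow> q2) F"
    unfolding u0 v0 by simp_all
  have J: "((\<lambda>p. skew_map G (Z p) (h p)) \<longlongrightarrow> skew_map G z0 l) F" if "(h \<longlongrightarrow> l) F" for h l
    by (rule bounded_bilinear.tendsto[OF bounded_bilinear_skew_map Zt that])
  have P1: "((\<lambda>p. part1 (Z p) x0) \<longlongrightarrow> part1 z0 x0) F" and P2: "((\<lambda>p. part2 (Z p) x0) \<longlongrightarrow> part2 z0 x0) F"
    unfolding part1_def part2_def using nz by (intro tendsto_intros J ft gt 1 2; simp)+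
  have "(X1 \<longlongrightarrow> (sqrt (2 * freq1 z0 * q1) / norm (part1 z0 x0)) *\<^sub>R part1 z0 x0) F"
    "(X2 \<longlongrightarrow> (sqrt (2 * freq2 z0 * q2) / norm (part2 z0 x0)) *\<^sub>R part2 z0 x0) F"
    unfolding X1_def X2_def using parts by (intro tendsto_intros P1 P2 1 2 Q1t Q2t; simp)+
  then have X1t: "(X1 \<longlongrightarrow> part1 z0 x0) F" and X2t: "(X2 \<longlongrightarrow> part2 z0 x0) F"
    unfolding q1[symmetric] q2[symmetric] using parts by (simp_all flip: norm_eq_sqrt_inner)
  have Xt: "((\<lambda>p. X1 p + X2 p) \<longlongrightarrow> x0) F"
    using tendsto_add[OF X1t X2t] unfolding part1_plus_part2[OF nz(1,2)] .
  have pos: "2 * freq1 z0 * q1 > 0" "2 * freq2 z0 * q2 > 0"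
    unfolding q1[symmetric] q2[symmetric] using parts by simp_all
  have ev: "\<forall>\<^sub>F p in F. dist (X1 p + X2 p) x0 < e" "\<forall>\<^sub>F p in F. dist (Z p) z0 < e"
    "\<forall>\<^sub>F p in F. U p \<noteq> 0" "\<forall>\<^sub>F p in F. V p \<noteq> 0" "\<forall>\<^sub>F p in F. U p + V p \<noteq> 0"
    "\<forall>\<^sub>F p in F. freq_sum (Z p) \<noteq> 0" "\<forall>\<^sub>F p in F. freq_diff (Z p) \<noteq> 0" "\<forall>\<^sub>F p in F. pfaffian (Z p) \<noteq> 0"
    "\<forall>\<^sub>F p in F. part1 (Z p) x0 \<noteq> 0" "\<forall>\<^sub>F p in F. part2 (Z p) x0 \<noteq> 0"
    "\<forall>\<^sub>F p in F. 2 * freq1 (Z p) * Q1 p > 0" "\<forall>\<^sub>F p in F. 2 * freq2 (Z p) * Q2 p > 0"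
    using tendstoD[OF Xt \<open>e > 0\<close>] tendstoD[OF Zt \<open>e > 0\<close>]
      tendsto_imp_eventually_ne[OF Ut uv(1)] tendsto_imp_eventually_ne[OF Vt uv(2)]
      tendsto_imp_eventually_ne[OF tendsto_add[OF Ut Vt] uv(3)]
      tendsto_imp_eventually_ne[OF ft nz(1)] tendsto_imp_eventually_ne[OF gt nz(2)]
      tendsto_imp_eventually_ne[OF pft nz(3)] tendsto_imp_eventually_ne[OF P1 parts(1)]
      tendsto_imp_eventually_ne[OF P2 parts(2)]
      order_tendstoD(1)[OF tendsto_mult[OF tendsto_mult[OF tendsto_const 1] Q1t] pos(1)]
      order_tendstoD(1)[OF tendsto_mult[OF tendsto_mult[OF tendsto_const 2] Q2t] pos(2)]
    by auto
  have main: "\<forall>\<^sub>F p in F. dist (X1 p + X2 p) x0 < e \<and> dist (Z p) z0 < e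
    \<and> skew_map G (Z p) (skew_map G (Z p) (X1 p)) = - ((freq1 (Z p))\<^sup>2) *\<^sub>R X1 p
    \<and> skew_map G (Z p) (skew_map G (Z p) (X2 p)) = - ((freq2 (Z p))\<^sup>2) *\<^sub>R X2 p
    \<and> freq1 (Z p) \<noteq> 0 \<and> freq2 (Z p) \<noteq> 0 \<and> (freq1 (Z p))\<^sup>2 \<noteq> (freq2 (Z p))\<^sup>2
    \<and> closing_translation G (Z p) (freq1 (Z p)) (freq2 (Z p)) (X1 p) (X2 p) = fst p"
    using ev
  proof eventually_elim
    case (elim p)
    let ?z = "Z p"
    have E1: "skew_map G ?z (skew_map G ?z (X1 p)) = - ((freq1 ?z)\<^sup>2) *\<^sub>R X1 p"
      and E2: "skew_map G ?z (skew_map G ?z (X2 p)) = - ((freq2 ?z)\<^sup>2) *\<^sub>R X2 p"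
      by (simp_all add: X1_def X2_def skew_map_simps skew_map_part mult.commute)
    have n1: "X1 p \<bullet> X1 p = 2 * freq1 ?z * Q1 p" and n2: "X2 p \<bullet> X2 p = 2 * freq2 ?z * Q2 p"
      using elim by (simp_all add: X1_def X2_def dot_square_norm power_divide)
    have "(U p - 1) * freq_sum ?z = Q1 p + Q2 p" "(V p - 1) * freq_diff ?z = Q1 p - Q2 p"
      by (simp_all add: Q1_def Q2_def field_simps)
    with closing_translation_eigenvectors[OF elim(6-8) E1 E2 n1 n2]
    have "closing_translation G ?z (freq1 ?z) (freq2 ?z) (X1 p) (X2 p) =
        U p *\<^sub>R star_pos ?z + V p *\<^sub>R star_neg ?z + ((U p + V p) / 2) *\<^sub>R star_null ?z" by blast
    also have "\<dots> = fst p"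
      unfolding Z_def by (rule stretch_inv_stretch(2)[OF elim(3-5)])
    finally have "closing_translation G ?z (freq1 ?z) (freq2 ?z) (X1 p) (X2 p) = fst p" .
    moreover have "freq1 ?z \<noteq> 0" "freq2 ?z \<noteq> 0" "(freq1 ?z)\<^sup>2 \<noteq> (freq2 ?z)\<^sup>2"
      using freq_relations(4,5)[of ?z] elim(6-8) by auto
    ultimately show ?case using E1 E2 elim(1,2) by blast
  qed
  then show ?thesis
    unfolding F_def[symmetric]
  proof (rule eventually_mono)
    fix p :: "(real ^ 'e) \<times> real \<times> real"
    obtain y u v where p: "p = (y, u, v)" by (cases p)
    assume "dist (X1 p + X2 p) x0 < e \<and> dist (Z p) z0 < e
    \<and> skew_map G (Z p) (skew_map G (Z p) (X1 p)) = - ((freq1 (Z p))\<^sup>2) *\<^sub>R X1 p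
    \<and> skew_map G (Z p) (skew_map G (Z p) (X2 p)) = - ((freq2 (Z p))\<^sup>2) *\<^sub>R X2 p
    \<and> freq1 (Z p) \<noteq> 0 \<and> freq2 (Z p) \<noteq> 0 \<and> (freq1 (Z p))\<^sup>2 \<noteq> (freq2 (Z p))\<^sup>2
    \<and> closing_translation G (Z p) (freq1 (Z p)) (freq2 (Z p)) (X1 p) (X2 p) = fst p"
    moreover have "Z p = stretch_inv y u v" "fst p = y" by (simp_all add: p Z_def U_def V_def)
    ultimately show "case p of (y, u, v) \<Rightarrow> \<exists>X1 X2 z. z = stretch_inv y u v
    \<and> dist (X1 + X2) x0 < e \<and> dist z z0 < e
    \<and> skew_map G z (skew_map G z X1) = - ((freq1 z)\<^sup>2) *\<^sub>R X1
    \<and> skew_map G z (skew_map G z X2) = - ((freq2 z)\<^sup>2) *\<^sub>R X2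
    \<and> freq1 z \<noteq> 0 \<and> freq2 z \<noteq> 0 \<and> (freq1 z)\<^sup>2 \<noteq> (freq2 z)\<^sup>2
    \<and> closing_translation G z (freq1 z) (freq2 z) X1 X2 = y"
      unfolding p by (intro case_prodI exI[of _ "X1 p"] exI[of _ "X2 p"] exI[of _ "Z p"]) (simp add: p)
  qed
qed

end

section \<open>Making both frequencies rational\<close>

text \<open>
  For \<open>t = v / u\<close> the radicands are, up to the factor \<open>u^2\<close>, the squares of \<open>\<theta>1 - \<theta>2\<close> (numerator) and
  \<open>\<theta>1 + \<theta>2\<close> (denominator) as functions of \<open>t\<close>. Their quotient is a rational function with a pole at
  \<open>0\<close>, hence not constant on any interval, and the intermediate value theorem yields rational values of
  its root.
\<close>
lemma exists_rational_frequency_ratio: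
  fixes A B C t0 \<delta> :: real
  assumes "A > 0" "B > 0" "C \<ge> 0" "t0 \<noteq> 0" "1 + t0 \<noteq> 0" "\<delta> > 0"
  shows "\<exists>t. \<bar>t - t0\<bar> < \<delta> \<and> t \<noteq> 0 \<and> 1 + t \<noteq> 0 \<and>
    sqrt ((2 * B / t\<^sup>2 + 4 * C / (1 + t)\<^sup>2) / (2 * A + 4 * C / (1 + t)\<^sup>2)) \<in> \<rat>"
proof -
  define F where "F t = 2 * A + 4 * C / (1 + t)\<^sup>2" for t
  define H where "H t = 2 * B / t\<^sup>2 + 4 * C / (1 + t)\<^sup>2" for t
  define R where "R t = sqrt (H t / F t)" for t
  define \<eta> where "\<eta> = Min {\<delta>, \<bar>t0\<bar>, \<bar>1 + t0\<bar>}"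
  have \<eta>: "\<eta> > 0" "\<eta> \<le> \<delta>" "\<eta> \<le> \<bar>t0\<bar>" "\<eta> \<le> \<bar>1 + t0\<bar>"
    using assms by (auto simp: \<eta>_def)
  define I where "I = {t0 - \<eta> <..< t0 + \<eta>}"
  have I: "t \<noteq> 0" "1 + t \<noteq> 0" "\<bar>t - t0\<bar> < \<delta>" if "t \<in> I" for t
    using that \<eta> by (auto simp: I_def)
  have F_pos: "F t > 0" for t
    using assms(1,3) by (simp add: F_def add_pos_nonneg)
  have H_pos: "H t > 0" if "t \<in> I" for t
    using assms(2,3) I(1)[OF that] by (simp add: H_def add_pos_nonneg)
  have cont: "continuous_on I R"
    unfolding R_def H_def F_def
    using I F_pos by (intro continuous_intros) (auto simp: F_def less_le)
  have "\<exists>t1\<in>I. \<exists>t2\<in>I. R t1 < R t2"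
  proof (rule ccontr)
    assume "\<not> ?thesis"
    then have eq: "R t = R t0" if "t \<in> I" for t
      using that \<eta>(1) by (metis I_def greaterThanLessThan_iff less_add_same_cancel1 linorder_neqE_linordered_idom diff_less_eq)
    define k where "k = (R t0)\<^sup>2"
    \<comment> \<open>clearing denominators in \<open>H t = k * F t\<close>; the constant coefficient does not vanish\<close>
    define p where "p = [:2 * B, 4 * B, 2 * B + 4 * C - k * (2 * A + 4 * C), - (4 * k * A), - (2 * k * A):]"
    have "poly p t = 0" if "t \<in> I" for t
    proof -
      have "(R t)\<^sup>2 = H t / F t"
        using H_pos[OF that] F_pos[of t] by (simp add: R_def less_imp_le)
      then have "H t / F t = k" by (simp add: k_def eq[OF that])
      then have "H t = k * F t" using F_pos[of t] by (simp add: field_simps)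
      then have "H t * (t\<^sup>2 * (1 + t)\<^sup>2) = k * F t * (t\<^sup>2 * (1 + t)\<^sup>2)" by simp
      moreover have "H t * (t\<^sup>2 * (1 + t)\<^sup>2) = 2 * B * (1 + t)\<^sup>2 + 4 * C * t\<^sup>2"
        using I[OF that] by (simp add: H_def distrib_right)
      moreover have "F t * (t\<^sup>2 * (1 + t)\<^sup>2) = (2 * A * (1 + t)\<^sup>2 + 4 * C) * t\<^sup>2"
        using I[OF that] by (simp add: F_def distrib_right)
      ultimately have "2 * B * (1 + t)\<^sup>2 + 4 * C * t\<^sup>2 = k * ((2 * A * (1 + t)\<^sup>2 + 4 * C) * t\<^sup>2)"
        by (simp add: mult.assoc)
      then show ?thesis
        by (simp add: p_def algebra_simps power2_eq_square)
    qed
    then have "I \<subseteq> {t. poly p t = 0}" by blast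
    moreover have "p \<noteq> 0" using assms(2) by (simp add: p_def)
    ultimately have "finite I" using poly_roots_finite finite_subset by blast
    then show False using \<eta>(1) infinite_Ioo[of "t0 - \<eta>" "t0 + \<eta>"] by (simp add: I_def)
  qed
  then obtain t1 t2 where t: "t1 \<in> I" "t2 \<in> I" "R t1 < R t2" by blast
  obtain r where r: "r \<in> \<rat>" "R t1 < r" "r < R t2" using Rats_dense_in_real[OF t(3)] by blast
  have "connected (R ` I)"
    using cont by (rule connected_continuous_image) (simp add: I_def)
  then have "{R t1..R t2} \<subseteq> R ` I"
    using t by (intro connected_contains_Icc) auto
  moreover have "r \<in> {R t1..R t2}" using r by simp
  ultimately obtain s where "s \<in> I" "r = R s" by blast
  then show ?thesis
    using I r(1) unfolding R_def H_def F_def by blast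
qed

text \<open>
  The ratio of the two roots depends on \<open>t = v / u\<close> alone. Once \<open>t\<close> makes it rational, \<open>u\<close> is a free
  scale, chosen to make the first root rational.
\<close>
lemma exists_rational_frequencies:
  fixes A B C u0 v0 \<delta> :: real
  assumes "A > 0" "B > 0" "C \<ge> 0" "u0 \<noteq> 0" "v0 \<noteq> 0" "u0 + v0 \<noteq> 0" "\<delta> > 0"
  shows "\<exists>u v. \<bar>u - u0\<bar> < \<delta> \<and> \<bar>v - v0\<bar> < \<delta> \<and> u \<noteq> 0 \<and> v \<noteq> 0 \<and> u + v \<noteq> 0 \<and>
    sqrt (2 * A / u\<^sup>2 + 4 * C / (u + v)\<^sup>2) \<in> \<rat> \<and> sqrt (2 * B / v\<^sup>2 + 4 * C / (u + v)\<^sup>2) \<in> \<rat>"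
proof -
  define t0 where "t0 = v0 / u0"
  have t0: "t0 \<noteq> 0" "1 + t0 \<noteq> 0" using assms by (auto simp: t0_def field_simps)
  have "\<delta> / (2 * \<bar>u0\<bar>) > 0" using assms by simp
  from exists_rational_frequency_ratio[OF assms(1-3) t0 this]
  obtain t where t: "\<bar>t - t0\<bar> < \<delta> / (2 * \<bar>u0\<bar>)" "t \<noteq> 0" "1 + t \<noteq> 0" and
    r: "sqrt ((2 * B / t\<^sup>2 + 4 * C / (1 + t)\<^sup>2) / (2 * A + 4 * C / (1 + t)\<^sup>2)) \<in> \<rat>" by blast
  define F where "F = 2 * A + 4 * C / (1 + t)\<^sup>2"
  define H where "H = 2 * B / t\<^sup>2 + 4 * C / (1 + t)\<^sup>2"
  have F: "F > 0" using assms(1,3) by (simp add: F_def add_pos_nonneg)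
  have H: "H > 0" using assms(2,3) t by (simp add: H_def add_pos_nonneg)
  define s0 where "s0 = sqrt F / u0"
  have s0: "s0 \<noteq> 0" "sqrt F / s0 = u0" using F assms(4) by (auto simp: s0_def)
  define \<epsilon> where "\<epsilon> = min \<delta> (\<delta> / (2 * \<bar>t\<bar>))"
  have \<epsilon>: "\<epsilon> > 0" using assms(7) t(2) by (simp add: \<epsilon>_def)
  have "((\<lambda>s. sqrt F / s) \<longlongrightarrow> u0) (nhds s0)"
    unfolding s0(2)[symmetric] using s0(1) by (intro tendsto_intros filterlim_ident) auto
  then have "\<forall>\<^sub>F s in nhds s0. dist (sqrt F / s) u0 < \<epsilon>" using \<epsilon> by (rule tendstoD)
  moreover have "\<forall>\<^sub>F s in nhds s0. s \<noteq> 0" using s0(1) by (rule t1_space_nhds)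
  ultimately have "\<forall>\<^sub>F s in nhds s0. dist (sqrt F / s) u0 < \<epsilon> \<and> s \<noteq> 0" by (rule eventually_conj)
  then obtain S where S: "open S" "s0 \<in> S" "\<And>s. s \<in> S \<Longrightarrow> dist (sqrt F / s) u0 < \<epsilon> \<and> s \<noteq> 0"
    unfolding eventually_nhds by blast
  have "s0 \<in> closure \<rat>" by (simp add: Rats_closure_real)
  then obtain s where s: "s \<in> \<rat>" "s \<in> S"
    using S(1,2) by (meson closure_iff_nhds_not_empty disjoint_iff subset_refl)
  define u where "u = sqrt F / s"
  define v where "v = t * u"
  have u: "\<bar>u - u0\<bar> < \<epsilon>" "s \<noteq> 0" "u \<noteq> 0" using S(3)[OF s(2)] F by (auto simp: u_def dist_real_def)
  have "v - v0 = t * (u - u0) + u0 * (t - t0)"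
    using assms(4) by (simp add: v_def t0_def algebra_simps)
  then have "\<bar>v - v0\<bar> \<le> \<bar>t\<bar> * \<bar>u - u0\<bar> + \<bar>u0\<bar> * \<bar>t - t0\<bar>"
    by (metis abs_mult abs_triangle_ineq)
  also have "\<dots> < \<delta> / 2 + \<delta> / 2"
  proof (rule add_strict_mono)
    have "\<bar>u - u0\<bar> < \<delta> / (2 * \<bar>t\<bar>)" using u(1) by (simp add: \<epsilon>_def)
    then show "\<bar>t\<bar> * \<bar>u - u0\<bar> < \<delta> / 2" using t(2) by (simp add: field_simps)
    show "\<bar>u0\<bar> * \<bar>t - t0\<bar> < \<delta> / 2" using t(1) assms(4) by (simp add: field_simps)
  qed
  finally have v: "\<bar>v - v0\<bar> < \<delta>" by simp
  have uv: "u + v = (1 + t) * u" by (simp add: v_def algebra_simps)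
  have "2 * A / u\<^sup>2 + 4 * C / (u + v)\<^sup>2 = F / u\<^sup>2"
    using t u by (simp add: uv F_def power_mult_distrib add_divide_distrib)
  then have 1: "sqrt (2 * A / u\<^sup>2 + 4 * C / (u + v)\<^sup>2) = \<bar>s\<bar>"
    using F u by (simp add: u_def power_divide real_sqrt_abs)
  have "2 * B / v\<^sup>2 + 4 * C / (u + v)\<^sup>2 = H / u\<^sup>2"
    unfolding uv using t u by (simp add: v_def H_def power_mult_distrib add_divide_distrib)
  also have "\<dots> = (H / F) * s\<^sup>2" using F u by (simp add: u_def power_divide)
  finally have 2: "sqrt (2 * B / v\<^sup>2 + 4 * C / (u + v)\<^sup>2) = sqrt (H / F) * \<bar>s\<bar>"
    by (simp only: real_sqrt_mult real_sqrt_abs)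
  have "sqrt (H / F) \<in> \<rat>" using r by (simp add: H_def F_def)
  then have "sqrt (2 * A / u\<^sup>2 + 4 * C / (u + v)\<^sup>2) \<in> \<rat>" "sqrt (2 * B / v\<^sup>2 + 4 * C / (u + v)\<^sup>2) \<in> \<rat>"
    unfolding 1 2 using s(1) by simp_all
  moreover have "u + v \<noteq> 0" "v \<noteq> 0" using uv u t by (auto simp: v_def)
  moreover have "\<bar>u - u0\<bar> < \<delta>" using u(1) by (simp add: \<epsilon>_def)
  ultimately show ?thesis using v u by blast
qed

section \<open>Density of resonant vectors\<close>

lemma eventually_at_notin_finite:
  fixes a :: real
  assumes "finite S"
  shows "\<forall>\<^sub>F t in at a. t \<notin> S"
  using islimpt_finite[OF assms, of a] by (simp add: islimpt_iff_eventually)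

lemma eventually_at_poly_nonzero:
  fixes a :: real
  assumes "p \<noteq> 0"
  shows "\<forall>\<^sub>F t in at a. poly p t \<noteq> 0"
  using eventually_at_notin_finite[OF poly_roots_finite[OF assms], of a] by simp

lemma eventually_at_line_nonzero:
  fixes p q :: "'a::real_inner" and a :: real
  assumes "q \<noteq> 0"
  shows "\<forall>\<^sub>F t in at a. p + t *\<^sub>R q \<noteq> 0"
proof -
  have "[:p \<bullet> q, q \<bullet> q:] \<noteq> 0" using assms by simp
  from eventually_at_poly_nonzero[OF this, of a] show ?thesis
    by (rule eventually_mono) (auto simp flip: inner_scaleR_left inner_add_left)
qed

context four_vertex_graph
begin

lemma linear_parts: "linear (part1 z)" "linear (part2 z)"
  by (rule linearI; simp add: part1_def part2_def skew_map_simps algebra_simps)+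

text \<open>
  Compare traces: that of \<open>J(z)^2\<close> is \<open>-2 |z|^2\<close>, and that of \<open>-r\<close> on four coordinates is \<open>-4 r\<close>.
\<close>
lemma trace_of_scalar_square:
  assumes "\<And>x. skew_map G z (skew_map G z x) + r *\<^sub>R x = 0"
  shows "z \<bullet> z = 2 * r"
proof -
  have ne: "a \<noteq> b" "a \<noteq> c" "a \<noteq> d" "b \<noteq> c" "b \<noteq> d" "c \<noteq> d"
    "b \<noteq> a" "c \<noteq> a" "d \<noteq> a" "c \<noteq> b" "d \<noteq> b" "d \<noteq> c"
    using distinct by auto
  have axis_nth: "axis i (1::real) $ j = (if j = i then 1 else 0)" for i j :: 'v
    by (simp add: axis_def)
  have n: "skew_map G z x \<bullet> skew_map G z x = r * (x \<bullet> x)" for x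
  proof -
    have "skew_map G z (skew_map G z x) \<bullet> x = - (skew_map G z x \<bullet> skew_map G z x)"
      using edge_bracket_commute[of G "skew_map G z x" x] by (simp add: inner_skew_map)
    moreover have "skew_map G z (skew_map G z x) = - (r *\<^sub>R x)"
      using assms[of x] by (simp add: eq_neg_iff_add_eq_0)
    ultimately show ?thesis by simp
  qed
  have "(\<Sum>i\<in>UNIV. skew_map G z (axis i 1) \<bullet> skew_map G z (axis i 1)) = 2 * (z \<bullet> z)"
    by (simp add: sum_vertices inner_vertices skew_map_coordinates inner_edges[of z z] axis_nth
        ne algebra_simps)
  moreover have "(\<Sum>i\<in>UNIV. skew_map G z (axis i 1) \<bullet> skew_map G z (axis i 1)) = 4 * r"
    unfolding n sum_vertices by (simp add: inner_axis_axis)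
  ultimately show ?thesis by simp
qed

text \<open>
  If a component vanished identically, \<open>J(z)^2\<close> would be a scalar, and the trace would force the two
  frequencies to have equal squares.
\<close>
lemma exists_parts_nonzero:
  assumes "freq_sum z \<noteq> 0" "freq_diff z \<noteq> 0"
  shows "\<exists>x. part1 z x \<noteq> 0 \<and> part2 z x \<noteq> 0"
proof -
  have ne: "(freq1 z)\<^sup>2 \<noteq> (freq2 z)\<^sup>2"
    using freq_relations(5)[of z] assms by auto
  have "\<exists>x. part1 z x \<noteq> 0"
  proof (rule ccontr)
    assume "\<not> ?thesis"
    then have "skew_map G z (skew_map G z x) + (freq2 z)\<^sup>2 *\<^sub>R x = 0" for x
      using assms by (auto simp: part1_def)
    from trace_of_scalar_square[OF this] show False
      using freq_relations(3)[of z] ne by simp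
  qed
  moreover have "\<exists>x. part2 z x \<noteq> 0"
  proof (rule ccontr)
    assume "\<not> ?thesis"
    then have "skew_map G z (skew_map G z x) + (freq1 z)\<^sup>2 *\<^sub>R x = 0" for x
      using assms by (auto simp: part2_def)
    from trace_of_scalar_square[OF this] show False
      using freq_relations(3)[of z] ne by simp
  qed
  ultimately obtain x y where xy: "part1 z x \<noteq> 0" "part2 z y \<noteq> 0" by blast
  have add: "part1 z (x + y) = part1 z x + part1 z y" "part2 z (x + y) = part2 z x + part2 z y"
    by (simp_all add: linear_add[OF linear_parts(1)] linear_add[OF linear_parts(2)])
  show ?thesis
  proof (cases "part2 z x = 0 \<and> part1 z y = 0")
    case True
    then show ?thesis using xy add by (intro exI[of _ "x + y"]) simp
  next
    case False
    then show ?thesis using xy by blast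
  qed
qed

lemma freq_sum_diff_nonzero:
  "star_pos z \<noteq> 0 \<Longrightarrow> freq_sum z \<noteq> 0" "star_neg z \<noteq> 0 \<Longrightarrow> freq_diff z \<noteq> 0"
  unfolding freq_sum_def freq_diff_def freq_radicands
  by (simp_all add: add_nonneg_eq_0_iff)

lemma pfaffian_line: "pfaffian (z + t *\<^sub>R w) = poly [:pfaffian z, star z \<bullet> w, pfaffian w:] t"
proof -
  have "2 * pfaffian (z + t *\<^sub>R w) = (star z + t *\<^sub>R star w) \<bullet> (z + t *\<^sub>R w)"
    using inner_star_self[of "z + t *\<^sub>R w"] by (simp add: star_simps)
  also have "\<dots> = star z \<bullet> z + t * (star z \<bullet> w) + t * (star w \<bullet> z) + t * t * (star w \<bullet> w)"
    by (simp add: inner_add_left inner_add_right algebra_simps)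
  also have "star w \<bullet> z = star z \<bullet> w"
    using star_inner[of w z] by (simp add: inner_commute)
  finally show ?thesis by (simp add: inner_star_self algebra_simps)
qed

text \<open>
  Along the line from \<open>z\<close> in the direction \<open>e1 + 2 e6\<close> only finitely many points are bad. The two
  coefficients are chosen different in size because \<open>e1 + e6\<close> and \<open>e1 - e6\<close> are eigenvectors of the star
  operator and lack one of the two components. Here the perfect matching is used.
\<close>
lemma generic_central_vector:
  assumes "e1 \<bullet> e1 = 1" "e6 \<bullet> e6 = 1" "e > 0"
  shows "\<exists>z0. dist z0 z < e \<and> star_pos z0 \<noteq> 0 \<and> star_neg z0 \<noteq> 0 \<and> pfaffian z0 \<noteq> 0"
proof -
  define w where "w = e1 + 2 *\<^sub>R e6"
  have s: "star e1 = e6" "star e6 = e1"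
    using assms by (simp_all add: star_def edge_orthogonal_simps)
  have "star_pos w \<bullet> e1 = 3/2" "star_neg w \<bullet> e1 = - (1/2)"
    using assms
    by (simp_all add: w_def star_pos_def star_neg_def star_simps s inner_add_left inner_diff_left
        edge_orthogonal_simps)
  then have w: "star_pos w \<noteq> 0" "star_neg w \<noteq> 0" by auto
  have "pfaffian w = 2"
    using assms by (simp add: w_def pfaffian_def inner_add_left edge_orthogonal_simps)
  then have p: "[:pfaffian z, star z \<bullet> w, pfaffian w:] \<noteq> 0" by simp
  have lin: "star_pos (z + t *\<^sub>R w) = star_pos z + t *\<^sub>R star_pos w"
    "star_neg (z + t *\<^sub>R w) = star_neg z + t *\<^sub>R star_neg w" for t
    by (simp_all add: bounded_linear_star_parts[THEN bounded_linear.linear, THEN linear_add]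
        bounded_linear_star_parts[THEN bounded_linear.linear, THEN linear_scale])
  have "((\<lambda>t. z + t *\<^sub>R w) \<longlongrightarrow> z + 0 *\<^sub>R w) (at 0)" by (intro tendsto_intros)
  then have "((\<lambda>t. z + t *\<^sub>R w) \<longlongrightarrow> z) (at 0)" by simp
  from tendstoD[OF this \<open>e > 0\<close>]
  have "\<forall>\<^sub>F t in at 0. dist (z + t *\<^sub>R w) z < e" .
  moreover have "\<forall>\<^sub>F t in at 0. star_pos (z + t *\<^sub>R w) \<noteq> 0" "\<forall>\<^sub>F t in at 0. star_neg (z + t *\<^sub>R w) \<noteq> 0"
    unfolding lin using w by (intro eventually_at_line_nonzero; simp)+
  moreover have "\<forall>\<^sub>F t in at 0. pfaffian (z + t *\<^sub>R w) \<noteq> 0"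
    unfolding pfaffian_line by (rule eventually_at_poly_nonzero[OF p])
  ultimately have "\<forall>\<^sub>F t in at (0::real). dist (z + t *\<^sub>R w) z < e \<and> star_pos (z + t *\<^sub>R w) \<noteq> 0
      \<and> star_neg (z + t *\<^sub>R w) \<noteq> 0 \<and> pfaffian (z + t *\<^sub>R w) \<noteq> 0"
    by eventually_elim blast
  then show ?thesis
    using eventually_happens'[OF at_neq_bot] by blast
qed

text \<open>
  Both components are made nonzero by moving \<open>x\<close> along a line. Rescaling by \<open>t\<close> near \<open>1\<close> multiplies
  \<open>u - 1\<close> and \<open>v - 1\<close> by \<open>t^2\<close>, so \<open>u\<close>, \<open>v\<close> and \<open>u + v\<close> vanish for finitely many \<open>t\<close> only.
\<close>
lemma generic_vertex_vector:
  assumes f: "freq_sum z \<noteq> 0" and g: "freq_diff z \<noteq> 0" and p: "pfaffian z \<noteq> 0" and "e > 0"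
  shows "\<exists>x0 q1 q2 u v. dist x0 x < e \<and> part1 z x0 \<noteq> 0 \<and> part2 z x0 \<noteq> 0
    \<and> part1 z x0 \<bullet> part1 z x0 = 2 * freq1 z * q1 \<and> part2 z x0 \<bullet> part2 z x0 = 2 * freq2 z * q2
    \<and> (u - 1) * freq_sum z = q1 + q2 \<and> (v - 1) * freq_diff z = q1 - q2
    \<and> u \<noteq> 0 \<and> v \<noteq> 0 \<and> u + v \<noteq> 0"
proof -
  have ab: "freq1 z \<noteq> 0" "freq2 z \<noteq> 0" using freq_relations(4)[of z] p by auto
  obtain w where w: "part1 z w \<noteq> 0" "part2 z w \<noteq> 0" using exists_parts_nonzero[OF f g] by blast
  have lin: "part1 z (x + t *\<^sub>R w) = part1 z x + t *\<^sub>R part1 z w"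
    "part2 z (x + t *\<^sub>R w) = part2 z x + t *\<^sub>R part2 z w"
    "part1 z (t *\<^sub>R y) = t *\<^sub>R part1 z y" "part2 z (t *\<^sub>R y) = t *\<^sub>R part2 z y" for t x y
    by (simp_all add: linear_add[OF linear_parts(1)] linear_add[OF linear_parts(2)]
        linear_scale[OF linear_parts(1)] linear_scale[OF linear_parts(2)])
  have "((\<lambda>t. x + t *\<^sub>R w) \<longlongrightarrow> x + 0 *\<^sub>R w) (at 0)" by (intro tendsto_intros)
  then have "((\<lambda>t. x + t *\<^sub>R w) \<longlongrightarrow> x) (at 0)" by simp
  then have "\<forall>\<^sub>F t in at 0. dist (x + t *\<^sub>R w) x < e / 2"
    using \<open>e > 0\<close> by (auto dest: tendstoD[of _ _ _ "e/2"])
  moreover have "\<forall>\<^sub>F t in at 0. part1 z (x + t *\<^sub>R w) \<noteq> 0" "\<forall>\<^sub>F t in at 0. part2 z (x + t *\<^sub>R w) \<noteq> 0"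
    unfolding lin using w by (intro eventually_at_line_nonzero; simp)+
  ultimately have "\<forall>\<^sub>F t in at (0::real). dist (x + t *\<^sub>R w) x < e / 2 \<and> part1 z (x + t *\<^sub>R w) \<noteq> 0
      \<and> part2 z (x + t *\<^sub>R w) \<noteq> 0"
    by eventually_elim blast
  then obtain y where y: "dist y x < e / 2" "part1 z y \<noteq> 0" "part2 z y \<noteq> 0"
    using eventually_happens'[OF at_neq_bot] by blast
  define r1 where "r1 = (part1 z y \<bullet> part1 z y) / (2 * freq1 z)"
  define r2 where "r2 = (part2 z y \<bullet> part2 z y) / (2 * freq2 z)"
  define r3 where "r3 = (r1 + r2) / freq_sum z"
  define r4 where "r4 = (r1 - r2) / freq_diff z"
  have "((\<lambda>t. t *\<^sub>R y) \<longlongrightarrow> 1 *\<^sub>R y) (at 1)" by (intro tendsto_intros)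
  then have "((\<lambda>t. t *\<^sub>R y) \<longlongrightarrow> y) (at 1)" by simp
  then have "\<forall>\<^sub>F t in at 1. dist (t *\<^sub>R y) y < e / 2"
    using \<open>e > 0\<close> by (auto dest: tendstoD[of _ _ _ "e/2"])
  moreover have "\<forall>\<^sub>F t in at (1::real). poly [:1, 0, r3:] t \<noteq> 0" "\<forall>\<^sub>F t in at (1::real). poly [:1, 0, r4:] t \<noteq> 0"
    "\<forall>\<^sub>F t in at (1::real). poly [:2, 0, r3 + r4:] t \<noteq> 0" "\<forall>\<^sub>F t in at (1::real). poly [:0, 1:] t \<noteq> 0"
    by (intro eventually_at_poly_nonzero; simp)+
  ultimately have "\<forall>\<^sub>F t in at (1::real). dist (t *\<^sub>R y) y < e / 2 \<and> poly [:1, 0, r3:] t \<noteq> 0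
      \<and> poly [:1, 0, r4:] t \<noteq> 0 \<and> poly [:2, 0, r3 + r4:] t \<noteq> 0 \<and> poly [:0, 1:] t \<noteq> 0"
    by eventually_elim blast
  then obtain t where t: "dist (t *\<^sub>R y) y < e / 2" "poly [:1, 0, r3:] t \<noteq> 0"
      "poly [:1, 0, r4:] t \<noteq> 0" "poly [:2, 0, r3 + r4:] t \<noteq> 0" "poly [:0, 1:] t \<noteq> 0"
    using eventually_happens'[OF at_neq_bot] by blast
  have "dist (t *\<^sub>R y) x < e"
    using dist_triangle[of "t *\<^sub>R y" x y] t(1) y(1) by simp
  moreover have "part1 z (t *\<^sub>R y) \<noteq> 0" "part2 z (t *\<^sub>R y) \<noteq> 0"
    using y t(5) by (simp_all add: lin)
  moreover have "part1 z (t *\<^sub>R y) \<bullet> part1 z (t *\<^sub>R y) = 2 * freq1 z * (t * t * r1)"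
    "part2 z (t *\<^sub>R y) \<bullet> part2 z (t *\<^sub>R y) = 2 * freq2 z * (t * t * r2)"
    using ab by (simp_all add: lin r1_def r2_def)
  moreover have "((1 + t * t * r3) - 1) * freq_sum z = t * t * r1 + t * t * r2"
    "((1 + t * t * r4) - 1) * freq_diff z = t * t * r1 - t * t * r2"
    using f g by (simp_all add: r3_def r4_def) (simp_all add: algebra_simps)
  moreover have "1 + t * t * r3 \<noteq> 0" "1 + t * t * r4 \<noteq> 0" "(1 + t * t * r3) + (1 + t * t * r4) \<noteq> 0"
    using t(2-4) by (simp_all add: algebra_simps)
  ultimately show ?thesis by blast
qed

end

lemma Rats_common_denominator:
  assumes "r \<in> \<rat>" "s \<in> (\<rat> :: real set)"
  shows "\<exists>(n::nat) k l. n > 0 \<and> r * real n = of_int k \<and> s * real n = of_int l"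
proof -
  obtain a b :: int where r: "b > 0" "r = of_int a / of_int b"
    using assms(1) by (elim Rats_cases') (rule that)
  obtain c d :: int where s: "d > 0" "s = of_int c / of_int d"
    using assms(2) by (elim Rats_cases') (rule that)
  have n: "real (nat (b * d)) = of_int b * of_int d" using r(1) s(1) by simp
  have "nat (b * d) > 0" using r(1) s(1) by simp
  moreover have "r * real (nat (b * d)) = of_int (a * d)" "s * real (nat (b * d)) = of_int (c * b)"
    unfolding n using r s by simp_all
  ultimately show ?thesis by blast
qed

text \<open>
  The initial velocities, in left trivialized form, to which \<open>closed_geodesic_of_resonant_vector\<close>
  applies.
\<close>
definition resonant_vectors ::
    "('v::finite, 'e::finite) pre_digraph \<Rightarrow> (real ^ 'e) set \<Rightarrow> ((real ^ 'v) \<times> (real ^ 'e)) set" where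
  "resonant_vectors G L = {(X1 + X2, Z) | X1 X2 Z. \<exists>\<theta>1 \<theta>2 \<omega> k1 k2.
     \<theta>1 \<noteq> 0 \<and> \<theta>2 \<noteq> 0 \<and> \<theta>1\<^sup>2 \<noteq> \<theta>2\<^sup>2
     \<and> skew_map G Z (skew_map G Z X1) = - (\<theta>1\<^sup>2) *\<^sub>R X1
     \<and> skew_map G Z (skew_map G Z X2) = - (\<theta>2\<^sup>2) *\<^sub>R X2
     \<and> \<omega> > 0 \<and> \<theta>1 * \<omega> = 2 * pi * of_int k1 \<and> \<theta>2 * \<omega> = 2 * pi * of_int k2
     \<and> \<omega> *\<^sub>R closing_translation G Z \<theta>1 \<theta>2 X1 X2 \<in> L}"

text \<open>
  Move the given vector to a generic one, its drift to a nearby resonant direction \<open>y\<close>, and then its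
  stretching factors to nearby values that make both frequencies rational. If \<open>n\<close> clears the
  denominators of the frequencies and \<open>2\<pi> m y\<close> lies in \<open>L\<close>, then \<open>\<omega> = 2\<pi> m n\<close> is a common period and
  \<open>\<omega> y\<close> lies in \<open>L\<close>.
\<close>
lemma (in four_vertex_graph) closure_resonant_vectors:
  assumes matching: "e1 \<bullet> e1 = 1" "e6 \<bullet> e6 = 1"
    and L: "\<And>k z. z \<in> L \<Longrightarrow> of_int k *\<^sub>R z \<in> L" "closure (resonant_directions L) = UNIV"
  shows "closure (resonant_vectors G L) = UNIV"
proof -
  have "\<exists>\<xi>\<in>resonant_vectors G L. dist \<xi> (x, z) < e" if "e > 0" for x z e
  proof -
    have e: "e / 4 > 0" using that by simp
    obtain z0 where z0: "dist z0 z < e / 4" "star_pos z0 \<noteq> 0" "star_neg z0 \<noteq> 0" "pfaffian z0 \<noteq> 0"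
      using generic_central_vector[OF matching e] by blast
    note fg = freq_sum_diff_nonzero(1)[OF z0(2)] freq_sum_diff_nonzero(2)[OF z0(3)]
    obtain x0 q1 q2 u0 v0 where x0: "dist x0 x < e / 4" "part1 z0 x0 \<noteq> 0" "part2 z0 x0 \<noteq> 0"
      "part1 z0 x0 \<bullet> part1 z0 x0 = 2 * freq1 z0 * q1" "part2 z0 x0 \<bullet> part2 z0 x0 = 2 * freq2 z0 * q2"
      "(u0 - 1) * freq_sum z0 = q1 + q2" "(v0 - 1) * freq_diff z0 = q1 - q2"
      "u0 \<noteq> 0" "v0 \<noteq> 0" "u0 + v0 \<noteq> 0"
      using generic_vertex_vector[OF fg z0(4) e] by blast
    define y0 where "y0 = u0 *\<^sub>R star_pos z0 + v0 *\<^sub>R star_neg z0 + ((u0 + v0) / 2) *\<^sub>R star_null z0"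
    have y0: "star_pos y0 = u0 *\<^sub>R star_pos z0" "star_neg y0 = v0 *\<^sub>R star_neg z0"
      unfolding y0_def by (rule star_parts_unique; simp add: star_simps star_eigen)+
    from closing_vector_perturbation[OF fg z0(4) x0(2-10) e, folded y0_def]
    obtain \<delta> where \<delta>: "\<delta> > 0" "\<And>y u v. dist (y, u, v) (y0, u0, v0) < \<delta> \<Longrightarrow>
      \<exists>X1 X2 z. z = stretch_inv y u v \<and> dist (X1 + X2) x0 < e / 4 \<and> dist z z0 < e / 4
        \<and> skew_map G z (skew_map G z X1) = - ((freq1 z)\<^sup>2) *\<^sub>R X1
        \<and> skew_map G z (skew_map G z X2) = - ((freq2 z)\<^sup>2) *\<^sub>R X2
        \<and> freq1 z \<noteq> 0 \<and> freq2 z \<noteq> 0 \<and> (freq1 z)\<^sup>2 \<noteq> (freq2 z)\<^sup>2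
        \<and> closing_translation G z (freq1 z) (freq2 z) X1 X2 = y"
      unfolding eventually_nhds_metric by fastforce
    have "\<forall>\<^sub>F y in nhds y0. dist y y0 < \<delta> / 3"
      using \<delta>(1) by (intro tendstoD[OF filterlim_ident]) simp
    moreover have "\<forall>\<^sub>F y in nhds y0. star_pos y \<noteq> 0" "\<forall>\<^sub>F y in nhds y0. star_neg y \<noteq> 0"
      using z0 x0 y0
      by (auto intro!: tendsto_imp_eventually_ne[OF bounded_linear.tendsto[OF bounded_linear_star_parts(1) filterlim_ident]]
          tendsto_imp_eventually_ne[OF bounded_linear.tendsto[OF bounded_linear_star_parts(2) filterlim_ident]])
    ultimately have "\<forall>\<^sub>F y in nhds y0. dist y y0 < \<delta> / 3 \<and> star_pos y \<noteq> 0 \<and> star_neg y \<noteq> 0"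
      by eventually_elim blast
    then obtain W where W: "open W" "y0 \<in> W" "\<And>y. y \<in> W \<Longrightarrow> dist y y0 < \<delta> / 3 \<and> star_pos y \<noteq> 0 \<and> star_neg y \<noteq> 0"
      unfolding eventually_nhds by blast
    have "y0 \<in> closure (resonant_directions L)" using L(2) by simp
    then obtain y where y: "y \<in> resonant_directions L" "y \<in> W"
      using W(1,2) by (meson closure_iff_nhds_not_empty disjoint_iff subset_refl)
    note yW = W(3)[OF y(2)]
    obtain u v where uv: "\<bar>u - u0\<bar> < \<delta> / 3" "\<bar>v - v0\<bar> < \<delta> / 3" "u \<noteq> 0" "v \<noteq> 0" "u + v \<noteq> 0"
      "sqrt (2 * (star_pos y \<bullet> star_pos y) / u\<^sup>2 + 4 * (star_null y \<bullet> star_null y) / (u + v)\<^sup>2) \<in> \<rat>"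
      "sqrt (2 * (star_neg y \<bullet> star_neg y) / v\<^sup>2 + 4 * (star_null y \<bullet> star_null y) / (u + v)\<^sup>2) \<in> \<rat>"
      using exists_rational_frequencies[of "star_pos y \<bullet> star_pos y" "star_neg y \<bullet> star_neg y"
          "star_null y \<bullet> star_null y" u0 v0 "\<delta> / 3"] yW x0(8-10) \<delta>(1) by auto
    define Z where "Z = stretch_inv y u v"
    have "freq_sum Z \<in> \<rat>" "freq_diff Z \<in> \<rat>"
      using uv(6,7) unfolding freq_sum_def freq_diff_def freq_radicands Z_def stretch_inv_parts
      by (simp_all add: power2_eq_square)
    then have rat: "freq1 Z \<in> \<rat>" "freq2 Z \<in> \<rat>" by (simp_all add: freq1_def freq2_def)
    have "dist (y, u, v) (y0, u0, v0) \<le> dist y y0 + dist (u, v) (u0, v0)"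
      unfolding dist_Pair_Pair[of y "(u, v)"] by (rule sqrt_sum_squares_le_sum) simp_all
    also have "dist (u, v) (u0, v0) \<le> dist u u0 + dist v v0"
      unfolding dist_Pair_Pair by (rule sqrt_sum_squares_le_sum) simp_all
    finally have "dist (y, u, v) (y0, u0, v0) < \<delta>"
      using uv(1,2) yW by (simp add: dist_real_def)
    from \<delta>(2)[OF this, folded Z_def] obtain X1 X2 where X: "dist (X1 + X2) x0 < e / 4" "dist Z z0 < e / 4"
        "skew_map G Z (skew_map G Z X1) = - ((freq1 Z)\<^sup>2) *\<^sub>R X1"
        "skew_map G Z (skew_map G Z X2) = - ((freq2 Z)\<^sup>2) *\<^sub>R X2"
        "freq1 Z \<noteq> 0" "freq2 Z \<noteq> 0" "(freq1 Z)\<^sup>2 \<noteq> (freq2 Z)\<^sup>2"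
        "closing_translation G Z (freq1 Z) (freq2 Z) X1 X2 = y" by blast
    obtain n k l where n: "n > 0" "freq1 Z * real n = of_int k" "freq2 Z * real n = of_int l"
      using Rats_common_denominator[OF rat] by blast
    obtain m :: nat where m: "m > 0" "(2 * pi * real m) *\<^sub>R y \<in> L"
      using y(1) by (auto simp: resonant_directions_def)
    define \<omega> where "\<omega> = 2 * pi * real m * real n"
    have "\<omega> > 0" using m n by (simp add: \<omega>_def)
    moreover have "freq1 Z * \<omega> = 2 * pi * of_int (int m * k)" "freq2 Z * \<omega> = 2 * pi * of_int (int m * l)"
      using n(2,3)[symmetric] by (simp_all add: \<omega>_def)
    moreover have "\<omega> *\<^sub>R closing_translation G Z (freq1 Z) (freq2 Z) X1 X2 \<in> L"
      unfolding X(8) using L(1)[OF m(2), of "int n"] by (simp add: \<omega>_def mult_ac)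
    ultimately have "(X1 + X2, Z) \<in> resonant_vectors G L"
      using X(3-7) unfolding resonant_vectors_def by blast
    moreover have "dist (X1 + X2, Z) (x, z) < e"
    proof -
      have "dist (X1 + X2, Z) (x, z) \<le> dist (X1 + X2) x + dist Z z"
        unfolding dist_Pair_Pair by (rule sqrt_sum_squares_le_sum) simp_all
      then show ?thesis
        using dist_triangle[of "X1 + X2" x x0] dist_triangle[of Z z z0] X(1,2) x0(1) z0(1) by simp
    qed
    ultimately show ?thesis by blast
  qed
  then show ?thesis
    unfolding closure_approachable[abs_def] by (auto simp: closure_approachable)
qed

section \<open>Density of closed geodesics\<close>

text \<open>
  Running through a geodesic at a different constant speed only changes the period.
\<close>
lemma resonant_vectors_scaleR:
  assumes "\<xi> \<in> resonant_vectors G L" "c > 0"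
  shows "c *\<^sub>R \<xi> \<in> resonant_vectors G L"
proof -
  obtain X1 X2 Z \<theta>1 \<theta>2 \<omega> k1 k2 where \<xi>: "\<xi> = (X1 + X2, Z)" and
    R: "\<theta>1 \<noteq> 0" "\<theta>2 \<noteq> 0" "\<theta>1\<^sup>2 \<noteq> \<theta>2\<^sup>2"
     "skew_map G Z (skew_map G Z X1) = - (\<theta>1\<^sup>2) *\<^sub>R X1"
     "skew_map G Z (skew_map G Z X2) = - (\<theta>2\<^sup>2) *\<^sub>R X2"
     "\<omega> > 0" "\<theta>1 * \<omega> = 2 * pi * of_int k1" "\<theta>2 * \<omega> = 2 * pi * of_int k2"
     "\<omega> *\<^sub>R closing_translation G Z \<theta>1 \<theta>2 X1 X2 \<in> L"
    using assms(1) unfolding resonant_vectors_def by auto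
  have "closing_translation G (c *\<^sub>R Z) (c * \<theta>1) (c * \<theta>2) (c *\<^sub>R X1) (c *\<^sub>R X2)
      = c *\<^sub>R closing_translation G Z \<theta>1 \<theta>2 X1 X2"
    using assms(2)
    by (simp add: closing_translation_def skew_map_simps edge_bracket_simps scaleR_add_right
        power_mult_distrib power2_eq_square)
  then have "(\<omega> / c) *\<^sub>R closing_translation G (c *\<^sub>R Z) (c * \<theta>1) (c * \<theta>2) (c *\<^sub>R X1) (c *\<^sub>R X2) \<in> L"
    using R(9) assms(2) by simp
  moreover have "skew_map G (c *\<^sub>R Z) (skew_map G (c *\<^sub>R Z) (c *\<^sub>R X1)) = - ((c * \<theta>1)\<^sup>2) *\<^sub>R c *\<^sub>R X1"
    "skew_map G (c *\<^sub>R Z) (skew_map G (c *\<^sub>R Z) (c *\<^sub>R X2)) = - ((c * \<theta>2)\<^sup>2) *\<^sub>R c *\<^sub>R X2"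
    using R(4,5) by (simp_all add: skew_map_simps power2_eq_square mult_ac)
  moreover have "(c * \<theta>1) * (\<omega> / c) = 2 * pi * of_int k1" "(c * \<theta>2) * (\<omega> / c) = 2 * pi * of_int k2"
    using R(7,8) assms(2) by simp_all
  moreover have "c * \<theta>1 \<noteq> 0" "c * \<theta>2 \<noteq> 0" "(c * \<theta>1)\<^sup>2 \<noteq> (c * \<theta>2)\<^sup>2" "\<omega> / c > 0"
    using R assms(2) by (simp_all add: power_mult_distrib)
  ultimately have "(c *\<^sub>R X1 + c *\<^sub>R X2, c *\<^sub>R Z) \<in> resonant_vectors G L"
    unfolding resonant_vectors_def by blast
  then show ?thesis by (simp add: \<xi> scaleR_add_right)
qed

lemma unit_tangent_bundle_iff:
  "(p, u) \<in> unit_tangent_bundle (graph_group G) \<longleftrightarrow> norm (u - (1/2) *\<^sub>R graph_bracket G p u) = 1"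
  by (simp add: unit_tangent_bundle_def left_invariant_metric_graph_group dot_square_norm
      power2_eq_1_iff) (smt (verit) norm_ge_zero)

text \<open>
  Resonance is a condition on the left trivialized velocity alone and survives positive scaling. So it
  holds on a dense subset of the unit sphere over every point, and the quotient map carries a dense
  set to a dense set.
\<close>
lemma density_from_resonant_vectors:
  fixes G :: "('v::finite, 'e::finite) pre_digraph"
  assumes \<Gamma>: "subgroup \<Gamma> (graph_group G)"
    and dense: "closure (resonant_vectors G (central_lattice \<Gamma>)) = UNIV"
  shows "density_of_closed_geodesics (graph_group G) \<Gamma>"
proof -
  let ?N = "graph_group G" and ?R = "resonant_vectors G (central_lattice \<Gamma>)"
  let ?\<pi> = "quotient_tangent ?N \<Gamma>" and ?Q = "quotient_unit_tangent_bundle ?N \<Gamma>"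
  define T where "T = unit_tangent_bundle ?N"
  define C where "C = {\<xi> \<in> topspace ?Q. \<exists>c t. closed_quotient_geodesic ?N \<Gamma> c \<and> has_quotient_velocity ?N \<Gamma> c \<xi> t}"
  define S where "S = {(p, u) \<in> T. u - (1/2) *\<^sub>R graph_bracket G p u \<in> ?R}"
  have shift: "left_diff ?N p 0 (u - (1/2) *\<^sub>R graph_bracket G p u) = u" for p u
    by (simp add: left_diff_graph_group graph_bracket_bilinear_simps
        bilinear_rsub[OF bilinear_graph_bracket])
  have unshift: "left_diff ?N p 0 \<xi> - (1/2) *\<^sub>R graph_bracket G p (left_diff ?N p 0 \<xi>) = \<xi>" for p \<xi>
    by (simp add: left_diff_graph_group graph_bracket_bilinear_simps)
  have topQ: "topspace ?Q = ?\<pi> ` T"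
    by (simp add: quotient_unit_tangent_bundle_def T_def)
  have S_C: "?\<pi> ` S \<subseteq> C"
  proof (rule image_subsetI)
    fix w assume "w \<in> S"
    then obtain p u where w: "w = (p, u)" "(p, u) \<in> T" "u - (1/2) *\<^sub>R graph_bracket G p u \<in> ?R"
      by (auto simp: S_def)
    obtain X1 X2 Z \<theta>1 \<theta>2 \<omega> k1 k2 where \<xi>: "u - (1/2) *\<^sub>R graph_bracket G p u = (X1 + X2, Z)" and
      R: "\<theta>1 \<noteq> 0" "\<theta>2 \<noteq> 0" "\<theta>1\<^sup>2 \<noteq> \<theta>2\<^sup>2"
       "skew_map G Z (skew_map G Z X1) = - (\<theta>1\<^sup>2) *\<^sub>R X1"
       "skew_map G Z (skew_map G Z X2) = - (\<theta>2\<^sup>2) *\<^sub>R X2"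
       "\<omega> > 0" "\<theta>1 * \<omega> = 2 * pi * of_int k1" "\<theta>2 * \<omega> = 2 * pi * of_int k2"
       "\<omega> *\<^sub>R closing_translation G Z \<theta>1 \<theta>2 X1 X2 \<in> central_lattice \<Gamma>"
      using w(3) unfolding resonant_vectors_def by auto
    have "(0, \<omega> *\<^sub>R closing_translation G Z \<theta>1 \<theta>2 X1 X2) \<in> \<Gamma>"
      using R(9) by (simp add: central_lattice_def)
    from closed_geodesic_of_resonant_vector[OF R(1-8) \<Gamma> this, of p]
    have "\<exists>c. closed_quotient_geodesic ?N \<Gamma> c \<and> has_quotient_velocity ?N \<Gamma> c (?\<pi> w) 0"
      unfolding \<xi>[symmetric] shift w(1) .
    moreover have "?\<pi> w \<in> topspace ?Q" using w(1,2) topQ by blast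
    ultimately show "?\<pi> w \<in> C" unfolding C_def by blast
  qed
  have "T \<subseteq> closure S"
  proof
    fix w assume "w \<in> T"
    obtain p u where w: "w = (p, u)" by (cases w)
    define \<xi> where "\<xi> = u - (1/2) *\<^sub>R graph_bracket G p u"
    have norm: "norm \<xi> = 1"
      using \<open>w \<in> T\<close> by (simp add: w T_def unit_tangent_bundle_iff \<xi>_def)
    have "\<xi> \<in> closure ?R" using dense by simp
    then obtain x where x: "\<forall>n. x n \<in> ?R" "x \<longlonglongrightarrow> \<xi>"
      unfolding closure_sequential by blast
    have lim: "(\<lambda>n. norm (x n)) \<longlonglongrightarrow> 1"
      using tendsto_norm[OF x(2)] by (simp add: norm)
    define y where "y n = (1 / norm (x n)) *\<^sub>R x n" for n
    have "\<forall>\<^sub>F n in sequentially. norm (x n) > 0"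
      by (rule order_tendstoD(1)[OF lim]) simp
    then have in_S: "\<forall>\<^sub>F n in sequentially. (p, left_diff ?N p 0 (y n)) \<in> S"
    proof (rule eventually_mono)
      fix n assume n: "norm (x n) > 0"
      have "y n \<in> ?R" unfolding y_def using x(1) n by (intro resonant_vectors_scaleR) auto
      moreover have "norm (y n) = 1" using n by (simp add: y_def)
      ultimately show "(p, left_diff ?N p 0 (y n)) \<in> S"
        by (simp add: S_def T_def unit_tangent_bundle_iff unshift)
    qed
    have "y \<longlonglongrightarrow> (1 / 1) *\<^sub>R \<xi>"
      unfolding y_def by (rule tendsto_scaleR[OF tendsto_divide[OF tendsto_const lim] x(2)]) simp
    then have y: "y \<longlonglongrightarrow> \<xi>" by simp
    have "bounded_linear (graph_bracket G p)"
      using bilinear_graph_bracket[of G] unfolding bilinear_def linear_conv_bounded_linear by blast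
    note br = bounded_linear.tendsto[OF this y]
    have "(\<lambda>n. (p, left_diff ?N p 0 (y n))) \<longlonglongrightarrow> (p, left_diff ?N p 0 \<xi>)"
      unfolding left_diff_graph_group by (intro tendsto_intros y br)
    moreover have "\<forall>\<^sub>F n in sequentially. (p, left_diff ?N p 0 (y n)) \<in> closure S"
      using in_S by (rule eventually_mono) (rule subsetD[OF closure_subset])
    ultimately have "(p, left_diff ?N p 0 \<xi>) \<in> closure S"
      by (intro Lim_in_closed_set[OF closed_closure _ sequentially_bot])
    then show "w \<in> closure S" by (simp add: w \<xi>_def shift)
  qed
  moreover have "S \<subseteq> T" by (auto simp: S_def)
  ultimately have cl: "top_of_set T closure_of S = T"
    by (simp add: closure_of_subtopology Int_absorb1 Int_absorb2)
  have cont: "continuous_map (top_of_set T) ?Q ?\<pi>"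
    unfolding quotient_unit_tangent_bundle_def T_def[symmetric]
    by (rule quotient_imp_continuous_map[OF quotient_map_quotient_topology])
  have "?\<pi> ` T \<subseteq> ?Q closure_of (?\<pi> ` S)"
    using continuous_map_image_closure_subset[OF cont, of S] by (simp add: cl)
  also have "\<dots> \<subseteq> ?Q closure_of C" by (rule closure_of_mono[OF S_C])
  finally have "?Q closure_of C = topspace ?Q"
    unfolding topQ[symmetric] by (simp add: closure_of_subset_topspace subset_antisym)
  then show ?thesis unfolding density_of_closed_geodesics_def C_def .
qed

lemma density_of_perfect_matching:
  fixes G :: "('v::finite, 'e::finite) pre_digraph"
  assumes G: "simple_digraph G" "verts G = UNIV" "arcs G = UNIV"
    and iso: "underlying_graph_iso G {0..<4::nat} F"
    and matching: "{i, j} \<in> F" "{k, l} \<in> F" "distinct [i, j, k, l]" "{i, j, k, l} = {0..<4}"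
    and \<Gamma>: "lattice_in (graph_group G) \<Gamma>"
  shows "density_of_closed_geodesics (graph_group G) \<Gamma>"
proof -
  obtain f where f: "bij_betw f {0..<4} (verts G)" "underlying_edges G = (\<lambda>s. f ` s) ` F"
    using iso by (auto simp: underlying_graph_iso_def)
  interpret four_vertex_graph G "f i" "f j" "f k" "f l"
  proof
    have "inj_on f {i, j, k, l}" using f(1) by (simp add: bij_betw_def matching(4))
    then show "distinct [f i, f j, f k, f l]" using matching(3) by (auto simp: inj_on_def)
    have "f ` {i, j, k, l} = UNIV" using f(1) G(2) unfolding matching(4) bij_betw_def by simp
    then show "UNIV = {f i, f j, f k, f l}" by simp
  qed (use G in auto)
  have edge: "edge (f x) (f y) \<bullet> edge (f x) (f y) = 1" if "{x, y} \<in> F" for x y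
  proof (rule norm_edge)
    have "{f x, f y} \<in> underlying_edges G"
      unfolding f(2) using imageI[OF that, of "\<lambda>s. f ` s"] by simp
    then obtain e where "{f x, f y} = {tail G e, head G e}"
      unfolding underlying_edges_def by blast
    then show "(f x, f y) \<in> arcs_ends G \<or> (f y, f x) \<in> arcs_ends G"
      using G(3) by (auto simp: arcs_ends_conv doubleton_eq_iff)
  qed
  have sub: "subgroup \<Gamma> (graph_group G)" using \<Gamma> by (simp add: lattice_in_def)
  note L = central_lattice_closed[OF sub]
  have "closure (resonant_directions (central_lattice \<Gamma>)) = UNIV"
    using span_central_lattice[OF G(1,3) \<Gamma>] by (intro closure_resonant_directions L)
  from closure_resonant_vectors[OF edge[OF matching(1)] edge[OF matching(2)] L(3) this]
  show ?thesis by (rule density_from_resonant_vectors[OF sub])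
qed

theorem corollary5p11:
  fixes G :: "('v::finite, 'e::finite) pre_digraph"
    and \<Gamma> :: "((real ^ 'v) \<times> (real ^ 'e)) set"
  assumes "simple_digraph G" and "verts G = UNIV" and "arcs G = UNIV"
    and "card (verts G) = 4"
    and "underlying_graph_iso G {0..<4} K4_edges \<or> underlying_graph_iso G {0..<4} G1_edges
       \<or> underlying_graph_iso G {0..<4} G2_edges \<or> underlying_graph_iso G {0..<4} C4_edges
       \<or> underlying_graph_iso G {0..<4} P4_edges"
    and "lattice_in (graph_group G) \<Gamma>"
  shows "density_of_closed_geodesics (graph_group G) \<Gamma>"
proof -
  note density = density_of_perfect_matching[OF assms(1-3) _ _ _ _ _ assms(6)]
  have n: "{0, 1, 2, 3} = {0..<4::nat}" "{0, 2, 1, 3} = {0..<4::nat}"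
    by auto
  \<comment> \<open>the edge \<open>{2, 3}\<close> is deleted in this graph, so it needs another matching than the others\<close>
  have "{0, 2} \<in> G1_edges" "{1, 3} \<in> G1_edges"
    by (auto simp: G1_edges_def K4_edges_def doubleton_eq_iff)
  then have "density_of_closed_geodesics (graph_group G) \<Gamma>" if "underlying_graph_iso G {0..<4} G1_edges"
    using density[OF that, of 0 2 1 3] n by simp
  moreover have "density_of_closed_geodesics (graph_group G) \<Gamma>"
    if "underlying_graph_iso G {0..<4} F" "{0, 1} \<in> F" "{2, 3} \<in> F" for F :: "nat set set"
    using density[OF that(1), of 0 1 2 3] that n by simp
  ultimately show ?thesis
    using assms(5) unfolding K4_edges_def G2_edges_def C4_edges_def P4_edges_def by blast
qed

end
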